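(* For every real $r>0$, $${}_2F_1\left(\frac13,\frac23;1;\alpha_r\right)=\frac{2}{\pi}\sqrt[4]{\frac{1-k_{r/3}^2+k_{r/3}^4}{1+8\alpha_r}}\;K\left(k_{r/3}^2\right).$$
   Context: ${}_2F_1(a,b;c;w)=\sum_{n\ge 0}\frac{(a)_n(b)_n}{(c)_n}\frac{w^n}{n!}$ for $|w|<1$, where $(a)_n=a(a+1)\cdots(a+n-1)$, $(a)_0=1$. $K(w)=\int_0^{\pi/2}\frac{dt}{\sqrt{1-w\sin^2 t}}$ for $0\le w<1$ is the complete elliptic integral of the first kind as a function of the parameter $w$ (the square of the modulus), so ${}_2F_1(\frac12,\frac12;1;w)=\frac2\pi K(w)$. For real $r>0$, $m_r\in(0,1)$ is the solution of $K(1-m_r)/K(m_r)=\sqrt r$, and $k_r=\sqrt{m_r}$ is the singular modulus. The cubic theta functions are, for $0<q<1$, $$a(q)=\sum_{m,n=-\infty}^{\infty}q^{m^2+mn+n^2},\qquad c(q)=\sum_{m,n=-\infty}^{\infty}q^{(m+1/3)^2+(m+1/3)(n+1/3)+(n+1/3)^2}.$$ For real $r>0$, with $q=e^{-\pi\sqrt r}$, the cubic singular modulus is $\alpha_r=\left(\frac{c(q^{2/\sqrt3})}{a(q^{2/\sqrt3})}\right)^3\in(0,1)$; it satisfies $\frac{{}_2F_1(\frac13,\frac23;1;1-\alpha_r)}{{}_2F_1(\frac13,\frac23;1;\alpha_r)}=\sqrt r$. Fourth roots are positive real roots. *)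

theory Defs
  imports "HOL-Analysis.Analysis"
begin

definition hypergeo_2F1 :: "real \<Rightarrow> real \<Rightarrow> real \<Rightarrow> real \<Rightarrow> real" where
  "hypergeo_2F1 a b c w =
     (\<Sum>n. pochhammer a n * pochhammer b n / pochhammer c n * (w ^ n / fact n))"

lemma hypergeo_2F1_eq_eval_fps:
  "hypergeo_2F1 a b c w = eval_fps (fps_hypergeo [a, b] [c] 1) w"
  by (simp add: hypergeo_2F1_def eval_fps_def fps_hypergeo_nth mult.assoc)

(* The argument is the parameter, i.e. the square of the modulus. *)
definition elliptic_K :: "real \<Rightarrow> real" where
  "elliptic_K w = integral {0..pi / 2} (\<lambda>t. 1 / sqrt (1 - w * (sin t)\<^sup>2))"

(* For r > 0 the equation has exactly one solution in the open unit interval, because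
   m \<mapsto> elliptic_K (1 - m) / elliptic_K m decreases strictly and continuously
   from infinity to 0 there. *)
definition singular_parameter :: "real \<Rightarrow> real" where
  "singular_parameter r =
     (THE m. 0 < m \<and> m < 1 \<and> elliptic_K (1 - m) / elliptic_K m = sqrt r)"

definition singular_modulus :: "real \<Rightarrow> real" where
  "singular_modulus r = sqrt (singular_parameter r)"

(* For 0 < q < 1 both double series have positive terms and converge, so the
   unordered sum over all pairs of integers agrees with the iterated one. *)
definition cubic_theta_a :: "real \<Rightarrow> real" where
  "cubic_theta_a q = (\<Sum>\<^sub>\<infinity>(m, n)\<in>(UNIV :: (int \<times> int) set). q powi (m\<^sup>2 + m * n + n\<^sup>2))"

definition cubic_theta_c :: "real \<Rightarrow> real" where
  "cubic_theta_c q = (\<Sum>\<^sub>\<infinity>(m, n)\<in>(UNIV :: (int \<times> int) set).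
     q powr ((of_int m + 1/3)\<^sup>2 + (of_int m + 1/3) * (of_int n + 1/3) + (of_int n + 1/3)\<^sup>2))"

definition cubic_singular_modulus :: "real \<Rightarrow> real" where
  "cubic_singular_modulus r =
     (let q = exp (- pi * sqrt r)
      in (cubic_theta_c (q powr (2 / sqrt 3)) / cubic_theta_a (q powr (2 / sqrt 3))) ^ 3)"

end

theory Submission
  imports Defs "HOL-Real_Asymp.Real_Asymp"
begin

text \<open>
  Put \<open>q = exp (- \<pi> sqrt (r/3))\<close>, so that \<open>\<alpha>\<^sub>r = (c/a)\<^sup>3\<close> at the nome \<open>q\<^sup>2\<close>. Three facts give the
  formula. (1) \<open>a = \<^sub>2F\<^sub>1(1/3, 2/3; 1; (c/a)\<^sup>3)\<close>: by the cubic transformation of \<open>\<^sub>2F\<^sub>1\<close> the quotient of the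
  two sides is invariant under \<open>q \<mapsto> q\<^sup>3\<close>, and it tends to 1 as \<open>q \<rightarrow> 0\<close>. (2) In the same way the Landen
  transformation gives \<open>\<theta>\<^sub>3\<^sup>2 = 2/\<pi> K(m)\<close> with \<open>m = (\<theta>\<^sub>2/\<theta>\<^sub>3)\<^sup>4\<close>, and \<open>K(1 - m)/K(m) = - ln q / \<pi>\<close>, because the
  left side doubles under \<open>q \<mapsto> q\<^sup>2\<close> and \<open>K(1 - m)\<close> is asymptotic to \<open>- ln m / 2\<close>; no modular
  transformation is needed. (3) \<open>a (a\<^sup>3 + 8 c\<^sup>3)\<close> at \<open>q\<^sup>2\<close> equals \<open>\<theta>\<^sub>3\<^sup>8 (1 - m + m\<^sup>2)\<close> at \<open>q\<close>, since both are the theta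
  series of the \<open>E\<^sub>8\<close> lattice, glued from four copies of \<open>A\<^sub>2\<close> along the tetracode or from eight copies
  of \<open>A\<^sub>1\<close> along the Hamming code. The theta identities behind the iterations in (1) and (2) are
  lattice isometries too.
\<close>

section \<open>Sums of extended nonnegative reals\<close>

text \<open>Each theta identity is a form-preserving bijection between the index sets of two series,
  so its proof is a polynomial identity plus an integral affine map with an integral inverse. The
  sums therefore live in \<open>ennreal\<close>, where regrouping and reindexing need no
  convergence; finiteness is shown once for each of the four series, and only then do the identities
  pass to the reals. The price is a semiring without subtraction. Exponents are half the norm of E8,
  so both gluings count its 240 minimal vectors at exponent 1: 24 + 8 * 27 from A2, 16 + 14 * 16
  from A1. The two transformations of the hypergeometric function hold because both sides solve the
  same self-adjoint equation, with the same value at its singular endpoint. Their arguments must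
  stay below 1, which needs c < a and theta2 < theta3; these also come from iteration, because a
  nonpositive difference would persist along q^(k^n), where the limit is 1. The third Borwein
  function b(q) = a(q^3) - c(q^3) is never named, but a^3 - c^3 = b^3 governs the cubic
  iteration.\<close>

definition esum :: "('a \<Rightarrow> ennreal) \<Rightarrow> ennreal" where
  "esum f = (\<integral>\<^sup>+ x. f x \<partial>count_space UNIV)"

lemma esum_cmult: "c * esum f = esum (\<lambda>x. c * f x)"
  by (simp add: esum_def nn_integral_cmult)

lemma esum_multc: "esum f * c = esum (\<lambda>x. f x * c)"
  by (simp add: esum_def nn_integral_multc)

lemma esum_add: "esum f + esum g = esum (\<lambda>x. f x + g x)"
  by (simp add: esum_def nn_integral_add)

lemma esum_mono: "(\<And>x. f x \<le> g x) \<Longrightarrow> esum f \<le> esum g"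
  by (simp add: esum_def nn_integral_mono)

lemma esum_pair: "esum (\<lambda>x. esum (\<lambda>y. f x y)) = esum (\<lambda>z. f (fst z) (snd z))"
  using nn_integral_fst_count_space[of "\<lambda>z. f (fst z) (snd z)"] by (simp add: esum_def)

lemma esum_swap: "esum (\<lambda>x. esum (\<lambda>y. f x y)) = esum (\<lambda>y. esum (\<lambda>x. f x y))"
  using nn_integral_fst_count_space[of "\<lambda>z. f (fst z) (snd z)"]
    nn_integral_snd_count_space[of "\<lambda>z. f (fst z) (snd z)"] by (simp add: esum_def)

lemma esum_reindex: "bij g \<Longrightarrow> esum (\<lambda>x. f (g x)) = esum f"
  unfolding esum_def by (rule nn_integral_bij_count_space) simp

lemma esum_reindex_inverse:
  assumes "\<And>x. h (g x) = x" "\<And>y. g (h y) = y"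
  shows "esum (\<lambda>x. f (g x)) = esum f"
  by (rule esum_reindex) (rule o_bij[of h g]; use assms in \<open>auto simp: o_def\<close>)

lemma esum_shift: "esum (\<lambda>x. f (x + c)) = esum f" for c :: int
  by (rule esum_reindex_inverse[where h = "\<lambda>x. x - c"]) auto

lemma esum_residues:
  fixes f :: "int \<Rightarrow> ennreal"
  assumes "k > 0"
  shows "esum f = (\<Sum>w<k. esum (\<lambda>x. f (int k * x + int w)))"
proof -
  have eq: "esum f = esum (\<lambda>x. \<Sum>w<k. if x mod int k = int w then f x else 0)"
  proof (rule arg_cong[where f = esum], rule ext)
    fix x
    have *: "x mod int k = int w \<longleftrightarrow> nat (x mod int k) = w" for w
      using assms by auto
    have "nat (x mod int k) < k"
      using assms by (simp add: nat_less_iff)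
    then show "f x = (\<Sum>w<k. if x mod int k = int w then f x else 0)"
      by (simp add: *)
  qed
  have "esum (\<lambda>x. \<Sum>w<k. if x mod int k = int w then f x else 0) =
        (\<Sum>w<k. esum (\<lambda>x. if x mod int k = int w then f x else 0))"
    unfolding esum_def by (rule nn_integral_sum) auto
  also have "\<dots> = (\<Sum>w<k. esum (\<lambda>x. f (int k * x + int w)))"
  proof (rule sum.cong[OF refl])
    fix w assume "w \<in> {..<k}"
    then have w: "w < k" by simp
    have "esum (\<lambda>x. f (int k * x + int w)) =
          (\<integral>\<^sup>+ x. f x \<partial>count_space {x. x mod int k = int w})"
      unfolding esum_def
    proof (rule nn_integral_bij_count_space)
      show "bij_betw (\<lambda>x. int k * x + int w) UNIV {x. x mod int k = int w}"
        by (rule bij_betw_byWitness[where f' = "\<lambda>x. x div int k"])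
          (use w in \<open>auto intro: mult_div_mod_eq\<close>, metis mult_div_mod_eq)
    qed
    also have "\<dots> = esum (\<lambda>x. if x mod int k = int w then f x else 0)"
      unfolding esum_def
      by (subst nn_integral_count_space_indicator)
        (auto intro!: nn_integral_cong simp: indicator_def)
    finally show "esum (\<lambda>x. if x mod int k = int w then f x else 0) =
        esum (\<lambda>x. f (int k * x + int w))" ..
  qed
  finally show ?thesis using eq by simp
qed

lemma esum_mod2: "esum f = esum (\<lambda>x. f (2 * x)) + esum (\<lambda>x. f (2 * x + 1))"
  for f :: "int \<Rightarrow> ennreal"
  by (subst esum_residues[of 2]) (simp_all add: numeral_2_eq_2)

lemma esum_mod3:
  "esum f = esum (\<lambda>x. f (3 * x)) + esum (\<lambda>x. f (3 * x + 1)) + esum (\<lambda>x. f (3 * x + 2))"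
  for f :: "int \<Rightarrow> ennreal"
  by (subst esum_residues[of 3]) (simp_all add: numeral_3_eq_3)

text \<open>The passage back to the reals: a finite \<open>esum\<close> makes the family absolutely
  summable, so the unordered sum \<open>infsum\<close> has the same value.\<close>

lemma esum_ennreal:
  assumes "\<And>x. f x \<ge> 0" "esum (\<lambda>x. ennreal (f x)) \<noteq> top"
  shows "esum (\<lambda>x. ennreal (f x)) = ennreal (infsum f UNIV)"
proof -
  have "integrable (count_space UNIV) f"
    using assms by (intro integrableI_nonneg) (auto simp: esum_def top.not_eq_extremum)
  then have abs: "Infinite_Set_Sum.abs_summable_on f UNIV"
    by (simp add: Infinite_Set_Sum.abs_summable_on_def)
  show ?thesis
    unfolding esum_def infsetsum_infsum[OF abs, symmetric]
    by (rule nn_integral_conv_infsetsum) (use abs assms in auto)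
qed

text \<open>A real exponent serves the shifted lattices, whose norms are fractions. The laws below
  hold for every real \<open>q\<close>, so the identities in \<open>ennreal\<close> carry no
  hypothesis on it.\<close>

definition epow :: "real \<Rightarrow> real \<Rightarrow> ennreal" where
  "epow q x = ennreal (q powr x)"

lemma epow_add: "epow q (x + y) = epow q x * epow q y"
  by (simp add: epow_def powr_add ennreal_mult)

lemma epow_powr: "epow (q powr a) x = epow q (a * x)"
  by (simp add: epow_def powr_powr)

section \<open>Theta series of rank two\<close>

text \<open>The norm |x - y\<omega>|^2 of an Eisenstein integer, with \<omega> a primitive cube root
  of unity; equivalently half the norm of the root lattice A2.\<close>

definition A2form :: "real \<Rightarrow> real \<Rightarrow> real" where
  "A2form x y = x\<^sup>2 + x * y + y\<^sup>2"

definition ethA :: "real \<Rightarrow> ennreal" where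
  "ethA q = esum (\<lambda>x::int. esum (\<lambda>y::int. epow q (A2form x y)))"

definition ethC :: "real \<Rightarrow> ennreal" where
  "ethC q = esum (\<lambda>x::int. esum (\<lambda>y::int. epow q (A2form (x + 1/3) (y + 1/3))))"

definition eth3 :: "real \<Rightarrow> ennreal" where
  "eth3 q = esum (\<lambda>x::int. epow q (x\<^sup>2))"

definition eth2 :: "real \<Rightarrow> ennreal" where
  "eth2 q = esum (\<lambda>x::int. epow q ((x + 1/2)\<^sup>2))"

lemma esum_pair_reindex:
  assumes "\<And>x y. h (g (x, y)) = (x, y)" "\<And>x y. g (h (x, y)) = (x, y)"
    and "\<And>x y. F x y = G (fst (g (x, y))) (snd (g (x, y)))"
  shows "esum (\<lambda>x. esum (\<lambda>y. F x y)) = esum (\<lambda>x. esum (\<lambda>y. G x y))"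
proof -
  have "esum (\<lambda>z. G (fst (g z)) (snd (g z))) = esum (\<lambda>z. G (fst z) (snd z))"
    by (rule esum_reindex_inverse[where h = h and f = "\<lambda>z. G (fst z) (snd z)"])
      (use assms in auto)
  then show ?thesis
    unfolding esum_pair using assms(3) by simp
qed

text \<open>Residues of \<open>y\<close> are counted from \<open>x\<close>, so the first part is the
  sublattice x \<equiv> y (mod 2) and the second its translate.\<close>

lemma esum_pair_mod2:
  fixes F :: "int \<Rightarrow> int \<Rightarrow> ennreal"
  shows "esum (\<lambda>x. esum (\<lambda>y. F x y)) =
    esum (\<lambda>x. esum (\<lambda>t. F x (x + 2 * t))) + esum (\<lambda>x. esum (\<lambda>t. F x (x + 2 * t + 1)))"
proof -
  have "esum (\<lambda>y. F x y) = esum (\<lambda>t. F x (x + 2 * t)) + esum (\<lambda>t. F x (x + 2 * t + 1))" for x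
    using esum_shift[of "F x" x] esum_mod2[of "\<lambda>y. F x (y + x)"] by (simp add: ac_simps)
  then show ?thesis by (simp add: esum_add)
qed

lemma esum_pair_mod3:
  fixes F :: "int \<Rightarrow> int \<Rightarrow> ennreal"
  shows "esum (\<lambda>x. esum (\<lambda>y. F x y)) =
    esum (\<lambda>x. esum (\<lambda>t. F x (x + 3 * t))) + esum (\<lambda>x. esum (\<lambda>t. F x (x + 3 * t + 1)))
    + esum (\<lambda>x. esum (\<lambda>t. F x (x + 3 * t + 2)))"
proof -
  have "esum (\<lambda>y. F x y) = esum (\<lambda>t. F x (x + 3 * t)) + esum (\<lambda>t. F x (x + 3 * t + 1))
     + esum (\<lambda>t. F x (x + 3 * t + 2))" for x
    using esum_shift[of "F x" x] esum_mod3[of "\<lambda>y. F x (y + x)"] by (simp add: ac_simps)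
  then show ?thesis by (simp add: esum_add)
qed

lemma esum_product: "esum f * esum g = esum (\<lambda>x. esum (\<lambda>y. f x * g y))"
  by (subst esum_multc) (simp add: esum_cmult)

text \<open>Rotation by 45 degrees: x^2 + y^2 is twice the sum of the squares of the half sum and
  the half difference, which are both integers if x and y have equal parity and both half-integers
  otherwise.\<close>

lemma eth3_square: "eth3 q ^ 2 = eth3 (q powr 2) ^ 2 + eth2 (q powr 2) ^ 2"
proof -
  have "eth3 q ^ 2 = esum (\<lambda>x::int. esum (\<lambda>y::int. epow q (x\<^sup>2 + y\<^sup>2)))"
    by (simp add: eth3_def power2_eq_square[of "esum _"] esum_product epow_add)
  also have "\<dots> = esum (\<lambda>x::int. esum (\<lambda>t::int. epow q (x\<^sup>2 + (x + 2 * t)\<^sup>2)))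
        + esum (\<lambda>x::int. esum (\<lambda>t::int. epow q (x\<^sup>2 + (x + 2 * t + 1)\<^sup>2)))"
    by (subst esum_pair_mod2) simp
  also have "esum (\<lambda>x::int. esum (\<lambda>t::int. epow q (x\<^sup>2 + (x + 2 * t)\<^sup>2))) =
      esum (\<lambda>x::int. esum (\<lambda>y::int. epow q (2 * x\<^sup>2 + 2 * y\<^sup>2)))"
    by (rule esum_pair_reindex[where g = "\<lambda>(x, t). (x + t, t)" and h = "\<lambda>(x, t). (x - t, t)"])
      (simp_all add: power2_eq_square algebra_simps)
  also have "\<dots> = eth3 (q powr 2) ^ 2"
    by (simp add: eth3_def epow_powr power2_eq_square[of "esum _"] esum_product epow_add)
  also have "esum (\<lambda>x::int. esum (\<lambda>t::int. epow q (x\<^sup>2 + (x + 2 * t + 1)\<^sup>2))) =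
      esum (\<lambda>x::int. esum (\<lambda>y::int. epow q (2 * (x + 1/2)\<^sup>2 + 2 * (y + 1/2)\<^sup>2)))"
    by (rule esum_pair_reindex[where g = "\<lambda>(x, t). (x + t, t)" and h = "\<lambda>(x, t). (x - t, t)"])
      (simp_all add: power2_eq_square algebra_simps)
  also have "\<dots> = eth2 (q powr 2) ^ 2"
    by (simp add: eth2_def epow_powr power2_eq_square[of "esum _"] esum_product epow_add)
  finally show ?thesis .
qed

text \<open>The same rotation on the shifted square lattice. Now exactly one of half sum and half
  difference is an integer, and which one depends on the parity class; the two classes contribute
  equally, whence the factor 2.\<close>

lemma eth2_square: "eth2 q ^ 2 = 2 * eth2 (q powr 2) * eth3 (q powr 2)"
proof -
  have *: "eth2 (q powr 2) * eth3 (q powr 2) =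
      esum (\<lambda>x::int. esum (\<lambda>y::int. epow q (2 * (x + 1/2)\<^sup>2 + 2 * y\<^sup>2)))"
    by (simp add: eth2_def eth3_def epow_powr esum_product epow_add)
  have "eth2 q ^ 2 = esum (\<lambda>x::int. esum (\<lambda>y::int. epow q ((x + 1/2)\<^sup>2 + (y + 1/2)\<^sup>2)))"
    by (simp add: eth2_def power2_eq_square[of "esum _"] esum_product epow_add)
  also have "\<dots> = esum (\<lambda>x::int. esum (\<lambda>t::int. epow q ((x + 1/2)\<^sup>2 + (x + 2 * t + 1/2)\<^sup>2)))
        + esum (\<lambda>x::int. esum (\<lambda>t::int. epow q ((x + 1/2)\<^sup>2 + (x + 2 * t + 1 + 1/2)\<^sup>2)))"
    by (subst esum_pair_mod2) simp
  also have "esum (\<lambda>x::int. esum (\<lambda>t::int. epow q ((x + 1/2)\<^sup>2 + (x + 2 * t + 1/2)\<^sup>2))) =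
      eth2 (q powr 2) * eth3 (q powr 2)"
    unfolding *
    by (rule esum_pair_reindex[where g = "\<lambda>(x, t). (x + t, t)" and h = "\<lambda>(x, t). (x - t, t)"])
      (simp_all add: power2_eq_square algebra_simps)
  also have "esum (\<lambda>x::int. esum (\<lambda>t::int. epow q ((x + 1/2)\<^sup>2 + (x + 2 * t + 1 + 1/2)\<^sup>2))) =
      eth2 (q powr 2) * eth3 (q powr 2)"
    unfolding *
    by (rule esum_pair_reindex[where g = "\<lambda>(x, t). (t, x + t + 1)" and h = "\<lambda>(x, t). (t - x - 1, x)"])
      (simp_all add: power2_eq_square algebra_simps)
  finally show ?thesis by (simp add: mult_2 distrib_right)
qed

lemma eth3_split: "eth3 q = eth3 (q powr 4) + eth2 (q powr 4)"
proof -
  have "eth3 q = esum (\<lambda>x::int. epow q (4 * x\<^sup>2)) + esum (\<lambda>x::int. epow q (4 * (x + 1/2)\<^sup>2))"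
    unfolding eth3_def by (subst esum_mod2) (simp add: power2_eq_square algebra_simps)
  then show ?thesis
    by (simp add: eth3_def eth2_def epow_powr)
qed

text \<open>The points with x \<equiv> y (mod 3) are the multiples of sqrt(-3), a copy of A2 with
  the form scaled by 3. The other two classes are translates of this copy, exchanged by
  negation.\<close>

lemma ethA_split: "ethA q = ethA (q powr 3) + 2 * ethC (q powr 3)"
proof -
  have A: "ethA (q powr 3) = esum (\<lambda>x::int. esum (\<lambda>y::int. epow q (3 * A2form x y)))"
    by (simp add: ethA_def epow_powr)
  have C: "ethC (q powr 3) = esum (\<lambda>x::int. esum (\<lambda>y::int. epow q (3 * A2form (x + 1/3) (y + 1/3))))"
    by (simp add: ethC_def epow_powr)
  have "ethA q = esum (\<lambda>x::int. esum (\<lambda>t::int. epow q (A2form (x + 3 * t) x)))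
     + esum (\<lambda>x::int. esum (\<lambda>t::int. epow q (A2form (x + 3 * t + 1) x)))
     + esum (\<lambda>x::int. esum (\<lambda>t::int. epow q (A2form (x + 3 * t + 2) x)))"
    unfolding ethA_def by (subst esum_swap, subst esum_pair_mod3) simp
  also have "esum (\<lambda>x::int. esum (\<lambda>t::int. epow q (A2form (x + 3 * t) x))) = ethA (q powr 3)"
    unfolding A
    by (rule esum_pair_reindex[where g = "\<lambda>(x, t). (x + t, t)" and h = "\<lambda>(x, t). (x - t, t)"])
      (simp_all add: A2form_def power2_eq_square algebra_simps)
  also have "esum (\<lambda>x::int. esum (\<lambda>t::int. epow q (A2form (x + 3 * t + 1) x))) = ethC (q powr 3)"
    unfolding C
    by (rule esum_pair_reindex[where g = "\<lambda>(x, t). (x + t, t)" and h = "\<lambda>(x, t). (x - t, t)"])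
      (simp_all add: A2form_def power2_eq_square algebra_simps)
  also have "esum (\<lambda>x::int. esum (\<lambda>t::int. epow q (A2form (x + 3 * t + 2) x))) = ethC (q powr 3)"
    unfolding C
    by (rule esum_pair_reindex[where g = "\<lambda>(x, t). (- x - t - 1, - t - 1)"
          and h = "\<lambda>(x, t). (t - x, - t - 1)"])
      (simp_all add: A2form_def power2_eq_square algebra_simps)
  finally show ?thesis by (simp add: mult_2 add.assoc)
qed

section \<open>Two descriptions of the E8 lattice\<close>

text \<open>Over a mere semiring numeral coefficients are not collected against repeated terms;
  writing 3, 8 and 14 as repeated sums lets both sides of an expanded identity be compared by
  reordering alone.\<close>

lemma times_numeral_unfold:
  fixes x :: "'a::comm_semiring_1"
  shows "3 * x = x + (x + x)"
    and "x * 8 = x + (x + (x + (x + (x + (x + (x + x))))))"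
    and "x * 14 = x + (x + (x + (x + (x + (x + (x + (x + (x + (x + (x + (x + (x + x))))))))))))"
proof -
  have "x * 3 = x + (x + x)"
    by (simp only: numeral.simps distrib_left mult_1_right add.assoc)
  then show "3 * x = x + (x + x)"
    by (simp only: mult.commute)
  show "x * 8 = x + (x + (x + (x + (x + (x + (x + x))))))"
    by (simp only: numeral.simps distrib_left mult_1_right add.assoc)
  show "x * 14 = x + (x + (x + (x + (x + (x + (x + (x + (x + (x + (x + (x + (x + x))))))))))))"
    by (simp only: numeral.simps distrib_left mult_1_right add.assoc)
qed

lemma esum6:
  "esum (\<lambda>a. esum (\<lambda>b. esum (\<lambda>c. esum (\<lambda>d. esum (\<lambda>e. esum (\<lambda>f. F a b c d e f)))))) =
   esum (\<lambda>(a, b, c, d, e, f). F a b c d e f)"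
  by (simp add: esum_pair case_prod_unfold)

lemma esum8:
  "esum (\<lambda>a. esum (\<lambda>b. esum (\<lambda>c. esum (\<lambda>d. esum (\<lambda>e. esum (\<lambda>f.
     esum (\<lambda>g. esum (\<lambda>h. F a b c d e f g h)))))))) =
   esum (\<lambda>(a, b, c, d, e, f, g, h). F a b c d e f g h)"
  by (simp add: esum_pair case_prod_unfold)

text \<open>The translate of A2 by (p/3, p/3). The values p = 0, 1, 2 represent the dual lattice
  modulo A2, the glue classes from which E8 is built.\<close>

definition A2coset :: "real \<Rightarrow> int \<Rightarrow> ennreal" where
  "A2coset q p = esum (\<lambda>s::int. esum (\<lambda>t::int. epow q (A2form (p/3 + s) (p/3 + t))))"

lemma A2coset_add3: "A2coset q (3 * x + w) = A2coset q w"
proof -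
  have "A2coset q w = esum (\<lambda>s::int. esum (\<lambda>t::int. epow q (A2form (w/3 + (s + x)) (w/3 + t))))"
    unfolding A2coset_def by (subst esum_shift[of _ x, symmetric]) simp
  also have "\<dots> = esum (\<lambda>s::int. esum (\<lambda>t::int. epow q (A2form (w/3 + (s + x)) (w/3 + (t + x)))))"
    by (subst (2) esum_shift[of _ x, symmetric]) simp
  also have "\<dots> = A2coset q (3 * x + w)"
    by (simp add: A2coset_def add_divide_distrib ac_simps)
  finally show ?thesis ..
qed

lemma A2coset_simps:
  "A2coset q 0 = ethA q" "A2coset q 1 = ethC q" "A2coset q 2 = ethC q"
  "A2coset q 3 = ethA q" "A2coset q 4 = ethC q" "A2coset q (-1) = ethC q" "A2coset q (-2) = ethC q"
proof -
  show 0: "A2coset q 0 = ethA q"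
    by (simp add: A2coset_def ethA_def)
  show 1: "A2coset q 1 = ethC q"
    by (simp add: A2coset_def ethC_def ac_simps)
  show 2: "A2coset q 2 = ethC q"
    unfolding A2coset_def ethC_def
    by (rule esum_pair_reindex[where g = "\<lambda>(x, t). (- x - 1, - t - 1)"
          and h = "\<lambda>(x, t). (- x - 1, - t - 1)"])
      (simp_all add: A2form_def power2_eq_square algebra_simps)
  show "A2coset q 3 = ethA q" "A2coset q 4 = ethC q" "A2coset q (-1) = ethC q" "A2coset q (-2) = ethC q"
    using A2coset_add3[of q 1 0] A2coset_add3[of q 1 1] A2coset_add3[of q "-1" 2]
      A2coset_add3[of q "-1" 1] 0 1 2 by simp_all
qed

text \<open>With p = 3s + w one index carries both the glue class w and the first lattice coordinate
  s, because p/3 = w/3 + s. A sum over all integers \<open>p\<close> thus runs through the three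
  cosets at once.\<close>

lemma esum_A2coset:
  fixes G :: "int \<Rightarrow> ennreal"
  assumes "\<And>x w. G (3 * x + w) = G w"
  shows "esum (\<lambda>p::int. esum (\<lambda>t::int. epow q (A2form (p/3) (p/3 + t))) * G p) =
    ethA q * G 0 + ethC q * G 1 + ethC q * G 2"
proof -
  have *: "esum (\<lambda>x::int. esum (\<lambda>t::int. epow q (A2form ((3 * x + w)/3) ((3 * x + w)/3 + t)))) = A2coset q w"
    for w :: int
  proof -
    have "esum (\<lambda>t::int. epow q (A2form ((3 * x + w)/3) ((3 * x + w)/3 + t))) =
        esum (\<lambda>t::int. epow q (A2form (w/3 + x) (w/3 + t)))" for x :: int
      using esum_shift[of "\<lambda>t. epow q (A2form (w/3 + x) (w/3 + t))" x]
      by (simp add: add_divide_distrib ac_simps)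
    then show ?thesis by (simp add: A2coset_def)
  qed
  have G: "G (3 * x) = G 0" for x
    using assms[of x 0] by simp
  show ?thesis
    using *[of 0] *[of 1] *[of 2]
    by (subst esum_mod3) (simp add: assms G A2coset_simps esum_multc[symmetric])
qed

definition A1coset :: "real \<Rightarrow> int \<Rightarrow> ennreal" where
  "A1coset q p = esum (\<lambda>s::int. epow q ((p/2 + s)\<^sup>2))"

lemma A1coset_add2: "A1coset q (2 * x + w) = A1coset q w"
proof -
  have "A1coset q w = esum (\<lambda>s::int. epow q ((w/2 + (s + x))\<^sup>2))"
    unfolding A1coset_def by (subst esum_shift[of _ x, symmetric]) simp
  also have "\<dots> = A1coset q (2 * x + w)"
    by (simp add: A1coset_def add_divide_distrib ac_simps)
  finally show ?thesis ..
qed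

lemma A1coset_simps:
  "A1coset q 0 = eth3 q" "A1coset q 1 = eth2 q" "A1coset q 2 = eth3 q" "A1coset q 3 = eth2 q"
proof -
  show 0: "A1coset q 0 = eth3 q"
    by (simp add: A1coset_def eth3_def)
  show 1: "A1coset q 1 = eth2 q"
    by (simp add: A1coset_def eth2_def ac_simps)
  show "A1coset q 2 = eth3 q" "A1coset q 3 = eth2 q"
    using A1coset_add2[of q 1 0] A1coset_add2[of q 1 1] 0 1 by simp_all
qed

lemma esum_A1coset:
  fixes G :: "int \<Rightarrow> ennreal"
  assumes "\<And>x w. G (2 * x + w) = G w"
  shows "esum (\<lambda>p::int. epow q ((p/2)\<^sup>2) * G p) = eth3 q * G 0 + eth2 q * G 1"
proof -
  have G: "G (2 * x) = G 0" for x
    using assms[of x 0] by simp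
  show ?thesis
    by (subst esum_mod2)
      (simp add: assms G esum_multc[symmetric] eth3_def eth2_def add_divide_distrib)
qed

text \<open>The words \<open>(p, r, p + r, p - r)\<close> over the field with three elements form the tetracode,
  whose weight enumerator is \<open>x\<^sup>4 + 8 x y\<^sup>3\<close>.\<close>

lemma tetracode_enumerator:
  "esum (\<lambda>p::int. esum (\<lambda>t::int. epow q (A2form (p/3) (p/3 + t))) *
     esum (\<lambda>r::int. esum (\<lambda>t::int. epow q (A2form (r/3) (r/3 + t))) *
       (A2coset q (p + r) * A2coset q (p - r)))) =
   ethA q ^ 4 + 8 * ethA q * ethC q ^ 3" (is "esum (\<lambda>p. ?h p * ?G p) = _")
proof -
  have G: "?G p = ethA q * (A2coset q p * A2coset q p) +
      ethC q * (A2coset q (p + 1) * A2coset q (p - 1)) +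
      ethC q * (A2coset q (p + 2) * A2coset q (p - 2))" for p
  proof (subst esum_A2coset)
    fix x w
    show "A2coset q (p + (3 * x + w)) * A2coset q (p - (3 * x + w)) =
        A2coset q (p + w) * A2coset q (p - w)"
      using A2coset_add3[of q x "p + w"] A2coset_add3[of q "-x" "p - w"]
      by (simp add: algebra_simps)
  qed simp
  show ?thesis
    unfolding G
  proof (subst esum_A2coset)
    fix x w
    show "ethA q * (A2coset q (3 * x + w) * A2coset q (3 * x + w)) +
        ethC q * (A2coset q (3 * x + w + 1) * A2coset q (3 * x + w - 1)) +
        ethC q * (A2coset q (3 * x + w + 2) * A2coset q (3 * x + w - 2)) =
        ethA q * (A2coset q w * A2coset q w) +
        ethC q * (A2coset q (w + 1) * A2coset q (w - 1)) +
        ethC q * (A2coset q (w + 2) * A2coset q (w - 2))"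
      by (simp add: A2coset_add3 add.assoc add_diff_eq[symmetric])
  next
    show "ethA q * (ethA q * (A2coset q 0 * A2coset q 0) +
        ethC q * (A2coset q (0 + 1) * A2coset q (0 - 1)) +
        ethC q * (A2coset q (0 + 2) * A2coset q (0 - 2))) +
        ethC q * (ethA q * (A2coset q 1 * A2coset q 1) +
        ethC q * (A2coset q (1 + 1) * A2coset q (1 - 1)) +
        ethC q * (A2coset q (1 + 2) * A2coset q (1 - 2))) +
        ethC q * (ethA q * (A2coset q 2 * A2coset q 2) +
        ethC q * (A2coset q (2 + 1) * A2coset q (2 - 1)) +
        ethC q * (A2coset q (2 + 2) * A2coset q (2 - 2))) = ethA q ^ 4 + 8 * ethA q * ethC q ^ 3"
      by (simp add: A2coset_simps algebra_simps power_numeral_reduce times_numeral_unfold)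
  qed
qed

text \<open>Modulo 2, \<open>a, b, c, d\<close> followed by the four sums of three of them are the words of the
  extended Hamming code of length 8.\<close>

lemma Hamming_enumerator:
  "esum (\<lambda>a::int. epow q ((a/2)\<^sup>2) * esum (\<lambda>b::int. epow q ((b/2)\<^sup>2) *
     esum (\<lambda>c::int. epow q ((c/2)\<^sup>2) * esum (\<lambda>d::int. epow q ((d/2)\<^sup>2) *
       (A1coset q (b + c + d) * A1coset q (a + c + d) * A1coset q (a + b + d) *
          A1coset q (a + b + c)))))) =
   eth3 q ^ 8 + 14 * eth3 q ^ 4 * eth2 q ^ 4 + eth2 q ^ 8"
proof -
  have p: "A1coset q (z + (2 * x + w)) = A1coset q (z + w)"
    "A1coset q (2 * x + w + z) = A1coset q (w + z)"
    "A1coset q (z + (2 * x + w) + u) = A1coset q (z + w + u)"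
    "A1coset q (2 * x + w + z + u) = A1coset q (w + z + u)" for x w z u
    using A1coset_add2[of q x "z + w"] A1coset_add2[of q x "z + w + u"] by (simp_all add: ac_simps)
  show ?thesis
    by (simp add: esum_A1coset p A1coset_simps A1coset_add2)
      (simp add: A1coset_simps algebra_simps power_numeral_reduce times_numeral_unfold)
qed

text \<open>Both sides are theta series of the \<open>E\<^sub>8\<close> lattice. The unimodular change of coordinates was
  found by a search among the 240 minimal vectors, onto which the basis vectors on the left must go.\<close>

lemma tetracode_Hamming_isometry:
  "esum (\<lambda>p::int. esum (\<lambda>t::int. epow q (A2form (p/3) (p/3 + t))) *
     esum (\<lambda>r::int. esum (\<lambda>t::int. epow q (A2form (r/3) (r/3 + t))) *
       (A2coset q (p + r) * A2coset q (p - r)))) =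
   esum (\<lambda>a::int. epow q ((a/2)\<^sup>2) * esum (\<lambda>b::int. epow q ((b/2)\<^sup>2) *
     esum (\<lambda>c::int. epow q ((c/2)\<^sup>2) * esum (\<lambda>d::int. epow q ((d/2)\<^sup>2) *
       (A1coset q (b + c + d) * A1coset q (a + c + d) * A1coset q (a + b + d) *
          A1coset q (a + b + c))))))" (is "?L = ?R")
proof -
  \<comment> \<open>Eight free integers on each side: \<open>p\<close> and \<open>r\<close> already
    contain the first coordinates of two A2 components, and \<open>u1\<close> to \<open>u4\<close>
    are the whole of four A1 components, as in \<open>esum_A2coset\<close> and
    \<open>esum_A1coset\<close>.\<close>
  let ?F = "\<lambda>(p::int, t1::int, r::int, t2::int, s3::int, t3::int, s4::int, t4::int).
    epow q (A2form (p/3) (p/3 + t1) + A2form (r/3) (r/3 + t2) +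
      A2form ((p + r)/3 + s3) ((p + r)/3 + t3) + A2form ((p - r)/3 + s4) ((p - r)/3 + t4))"
  let ?G = "\<lambda>(u1::int, u2::int, u3::int, u4::int, f1::int, f2::int, f3::int, f4::int).
    epow q ((u1/2)\<^sup>2 + (u2/2)\<^sup>2 + (u3/2)\<^sup>2 + (u4/2)\<^sup>2 +
      ((u2 + u3 + u4)/2 + f1)\<^sup>2 + ((u1 + u3 + u4)/2 + f2)\<^sup>2 +
      ((u1 + u2 + u4)/2 + f3)\<^sup>2 + ((u1 + u2 + u3)/2 + f4)\<^sup>2)"
  let ?g = "\<lambda>(p::int, t1::int, r::int, t2::int, s3::int, t3::int, s4::int, t4::int).
    (2 * p + t1 + s3 + t3 + s4 + t4, t1 + t2 - t3, t1 - s3, 2 * r + t2 + s3 + t3 - s4 - t4,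
     - t1 - r - t2 + s4, - p - t1 - r - s3 - t3, - p - t1 - r - t2 - s3, - p - t1 - t2 - s4 - t4)"
  let ?h = "\<lambda>(u1::int, u2::int, u3::int, u4::int, f1::int, f2::int, f3::int, f4::int).
    (u1 - u2 + u3 + 2 * f2 - 2 * f3 + f4, u2 - f2 + f3,
     - 2 * u1 - 2 * u2 - u4 - f2 - 2 * f3 - f4, u1 + u2 + u4 + f2 + f3, u2 - u3 - f2 + f3,
     u1 + u2 + u4 + 2 * f3, - u1 + f1 - f2 - f4, - u1 - u2 - u3 - u4 - f1 - f2 - f4)"
  have L: "?L = esum ?F"
  proof -
    have "?L = esum (\<lambda>p::int. esum (\<lambda>t1::int. epow q (A2form (p/3) (p/3 + t1)) *
        esum (\<lambda>r::int. esum (\<lambda>t2::int. epow q (A2form (r/3) (r/3 + t2)) *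
          esum (\<lambda>s3::int. esum (\<lambda>t3::int. epow q (A2form ((p + r)/3 + s3) ((p + r)/3 + t3)) *
            esum (\<lambda>s4::int. esum (\<lambda>t4::int. epow q (A2form ((p - r)/3 + s4) ((p - r)/3 + t4))))))))))"
      by (simp add: A2coset_def esum_multc)
    also have "\<dots> = esum ?F"
      by (simp add: esum_cmult esum8 epow_add mult.assoc)
    finally show ?thesis .
  qed
  have R: "?R = esum ?G"
  proof -
    have "?R = esum (\<lambda>u1::int. epow q ((u1/2)\<^sup>2) * esum (\<lambda>u2::int. epow q ((u2/2)\<^sup>2) *
      esum (\<lambda>u3::int. epow q ((u3/2)\<^sup>2) * esum (\<lambda>u4::int. epow q ((u4/2)\<^sup>2) *
      esum (\<lambda>f1::int. epow q (((u2 + u3 + u4)/2 + f1)\<^sup>2) *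
      esum (\<lambda>f2::int. epow q (((u1 + u3 + u4)/2 + f2)\<^sup>2) *
      esum (\<lambda>f3::int. epow q (((u1 + u2 + u4)/2 + f3)\<^sup>2) *
      esum (\<lambda>f4::int. epow q (((u1 + u2 + u3)/2 + f4)\<^sup>2)))))))))"
      by (simp add: A1coset_def esum_multc mult.assoc)
    also have "\<dots> = esum ?G"
      by (simp add: esum_cmult esum8 epow_add mult.assoc)
    finally show ?thesis .
  qed
  have eq: "?F = (\<lambda>z. ?G (?g z))"
    by (rule ext, simp only: split_paired_all prod.case, rule arg_cong[where f = "epow q"])
      (simp add: A2form_def field_simps power2_eq_square)
  show ?thesis
    unfolding L R eq by (rule esum_reindex_inverse[where h = ?h]) auto
qed

lemma ethA_ethC_eq_eth3_eth2:
  "ethA q ^ 4 + 8 * ethA q * ethC q ^ 3 = eth3 q ^ 8 + 14 * eth3 q ^ 4 * eth2 q ^ 4 + eth2 q ^ 8"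
  using tetracode_enumerator[of q] tetracode_Hamming_isometry[of q] Hamming_enumerator[of q] by simp

section \<open>The cubic theta identity\<close>

text \<open>The part of \<open>a\<close> with \<open>x - y \<equiv> w (mod 3)\<close>. In Eisenstein integers this is the
  residue class modulo \<open>\<theta> = sqrt (-3)\<close>.\<close>

definition A2class :: "real \<Rightarrow> int \<Rightarrow> ennreal" where
  "A2class q w = esum (\<lambda>y::int. esum (\<lambda>t::int. epow q (A2form (y + 3 * t + w) y)))"

lemma A2class_add3: "A2class q (3 * x + w) = A2class q w"
proof -
  have "A2class q w = esum (\<lambda>y::int. esum (\<lambda>t::int. epow q (A2form (y + 3 * (t + x) + w) y)))"
    unfolding A2class_def by (subst (2) esum_shift[of _ x, symmetric]) simp
  also have "\<dots> = A2class q (3 * x + w)"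
    by (simp add: A2class_def algebra_simps)
  finally show ?thesis ..
qed

lemma A2class_simps:
  "A2class q 0 = ethA (q powr 3)" "A2class q 1 = ethC (q powr 3)" "A2class q 2 = ethC (q powr 3)"
  "A2class q (-1) = ethC (q powr 3)" "A2class q (-2) = ethC (q powr 3)" "A2class q (-3) = ethA (q powr 3)"
proof -
  show 0: "A2class q 0 = ethA (q powr 3)"
    unfolding A2class_def ethA_def epow_powr
    by (rule esum_pair_reindex[where g = "\<lambda>(x, t). (x + t, t)" and h = "\<lambda>(x, t). (x - t, t)"])
      (simp_all add: A2form_def power2_eq_square algebra_simps)
  show 1: "A2class q 1 = ethC (q powr 3)"
    unfolding A2class_def ethC_def epow_powr
    by (rule esum_pair_reindex[where g = "\<lambda>(x, t). (x + t, t)" and h = "\<lambda>(x, t). (x - t, t)"])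
      (simp_all add: A2form_def power2_eq_square algebra_simps)
  show 2: "A2class q 2 = ethC (q powr 3)"
    unfolding A2class_def ethC_def epow_powr
    by (rule esum_pair_reindex[where g = "\<lambda>(x, t). (- x - t - 1, - t - 1)"
          and h = "\<lambda>(x, t). (t - x, - t - 1)"])
      (simp_all add: A2form_def power2_eq_square algebra_simps)
  show "A2class q (-1) = ethC (q powr 3)" "A2class q (-2) = ethC (q powr 3)"
    "A2class q (-3) = ethA (q powr 3)"
    using A2class_add3[of q "-1" 2] A2class_add3[of q "-1" 1] A2class_add3[of q "-1" 0] 0 1 2
    by simp_all
qed

lemma esum_A2class:
  fixes G :: "int \<Rightarrow> ennreal"
  assumes "\<And>x w. G (3 * x + w) = G w"
  shows "esum (\<lambda>x::int. esum (\<lambda>y::int. epow q (A2form x y) * G (x - y))) =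
    A2class q 0 * G 0 + A2class q 1 * G 1 + A2class q 2 * G 2"
proof -
  have "G (3 * x) = G 0" for x
    using assms[of x 0] by simp
  then show ?thesis
    unfolding A2class_def
    by (subst esum_swap, subst esum_pair_mod3)
      (simp add: assms add.assoc esum_multc add_diff_eq[symmetric])
qed

text \<open>Nine triples of classes have sum 1 modulo 3: the three orders of each of (1,0,0),
  (0,2,2) and (1,1,2). Class 0 contributes a factor \<open>ethA (q powr 3)\<close>, the other two a
  factor \<open>ethC (q powr 3)\<close>.\<close>

lemma class_one_enumerator:
  "esum (\<lambda>x::int. esum (\<lambda>y::int. epow q (A2form x y) *
     esum (\<lambda>z::int. esum (\<lambda>u::int. epow q (A2form z u) * A2class q (1 - (x - y) - (z - u)))))) =
   3 * (ethA (q powr 3) ^ 2 * ethC (q powr 3) + ethA (q powr 3) * ethC (q powr 3) ^ 2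
     + ethC (q powr 3) ^ 3)"
proof -
  let ?A = "A2class q"
  have per: "?A (c - (3 * x + w)) = ?A (c - w)" for c x w
    using A2class_add3[of q "-x" "c - w"] by (simp add: algebra_simps)
  have per': "?A (c - (3 * x + w) - d) = ?A (c - w - d)" for c x w d
    using A2class_add3[of q "-x" "c - w - d"] by (simp add: algebra_simps)
  have G: "esum (\<lambda>z::int. esum (\<lambda>u::int. epow q (A2form z u) * ?A (1 - v - (z - u)))) =
      ?A 0 * ?A (1 - v - 0) + ?A 1 * ?A (1 - v - 1) + ?A 2 * ?A (1 - v - 2)" for v
    by (rule esum_A2class) (rule per)
  show ?thesis
    unfolding G
    by (subst esum_A2class[where G = "\<lambda>v. ?A 0 * ?A (1 - v - 0) + ?A 1 * ?A (1 - v - 1) + ?A 2 * ?A (1 - v - 2)"])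
      (simp_all only: per', simp add: A2class_simps algebra_simps power_numeral_reduce times_numeral_unfold)
qed

text \<open>The offset \<open>c\<close> may depend on outer summation variables: taken as minus the
  classes of the first two coordinates of a triple, it sorts the triples by the class of the
  coordinate sum.\<close>

lemma esum_pair_classes:
  fixes F :: "int \<Rightarrow> int \<Rightarrow> ennreal"
  shows "esum (\<lambda>x. esum (\<lambda>y. F x y)) = esum (\<lambda>y. esum (\<lambda>t. F (y + c + 3 * t + 0) y))
    + esum (\<lambda>y. esum (\<lambda>t. F (y + c + 3 * t + 1) y)) + esum (\<lambda>y. esum (\<lambda>t. F (y + c + 3 * t + 2) y))"
proof -
  have "esum (\<lambda>x. F x y) = esum (\<lambda>t. F (y + c + 3 * t + 0) y) + esum (\<lambda>t. F (y + c + 3 * t + 1) y)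
     + esum (\<lambda>t. F (y + c + 3 * t + 2) y)" for y
    using esum_shift[of "\<lambda>x. F x y" "y + c"] esum_mod3[of "\<lambda>x. F (x + (y + c)) y"]
    by (simp add: ac_simps)
  then show ?thesis by (subst esum_swap) (simp add: esum_add)
qed

text \<open>In Eisenstein integers, \<open>c\<^sup>3\<close> runs over triples in \<open>1/\<theta> + Z[\<omega>]\<close>. It splits into three parts
  according to the class of the coordinate sum modulo \<open>\<theta>\<close>; multiplying the third coordinate by a
  power of \<open>\<omega>\<close> permutes the parts. The unitary matrix \<open>\<theta>\<^sup>-\<^sup>1 (\<omega>\<^bsup>ij\<^esup>)\<close> identifies one of them with the
  integral triples whose sum is \<open>1\<close> modulo \<open>\<theta>\<close>.\<close>

lemma ethC_cube_eq_class_one: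
  "ethC q ^ 3 = 3 * esum (\<lambda>x::int. esum (\<lambda>y::int. epow q (A2form x y) *
     esum (\<lambda>z::int. esum (\<lambda>u::int. epow q (A2form z u) * A2class q (1 - (x - y) - (z - u))))))"
  (is "_ = 3 * ?R")
proof -
  let ?e = "\<lambda>x y. epow q (A2form (real_of_int x + 1/3) (real_of_int y + 1/3))"
  let ?S = "\<lambda>w. esum (\<lambda>x1::int. esum (\<lambda>y1::int. ?e x1 y1 * esum (\<lambda>x2::int. esum (\<lambda>y2::int. ?e x2 y2 *
      esum (\<lambda>y3::int. esum (\<lambda>t::int. ?e (y3 + (- (x1 - y1) - (x2 - y2)) + 3 * t + w) y3))))))"
  let ?G = "\<lambda>(a1::int, b1::int, a2::int, b2::int, b3::int, s::int).
    epow q (A2form a1 b1 + A2form a2 b2 + A2form (b3 + 3 * s + (1 - (a1 - b1) - (a2 - b2))) b3)"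
  have C: "ethC q = esum (\<lambda>y::int. esum (\<lambda>t::int. ?e (y + c + 3 * t + 0) y))
    + esum (\<lambda>y::int. esum (\<lambda>t::int. ?e (y + c + 3 * t + 1) y))
    + esum (\<lambda>y::int. esum (\<lambda>t::int. ?e (y + c + 3 * t + 2) y))" for c
    unfolding ethC_def by (rule esum_pair_classes)
  have "ethC q ^ 3 = ethC q * (ethC q * ethC q)"
    by (simp add: power_numeral_reduce)
  also have "\<dots> = esum (\<lambda>x1::int. esum (\<lambda>y1::int. ?e x1 y1 * esum (\<lambda>x2::int. esum (\<lambda>y2::int. ?e x2 y2 * ethC q))))"
    by (subst (1 2) ethC_def) (simp add: esum_multc)
  also have "\<dots> = esum (\<lambda>x1::int. esum (\<lambda>y1::int. ?e x1 y1 * esum (\<lambda>x2::int. esum (\<lambda>y2::int. ?e x2 y2 *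
     (esum (\<lambda>y::int. esum (\<lambda>t::int. ?e (y + (- (x1 - y1) - (x2 - y2)) + 3 * t + 0) y))
    + esum (\<lambda>y::int. esum (\<lambda>t::int. ?e (y + (- (x1 - y1) - (x2 - y2)) + 3 * t + 1) y))
    + esum (\<lambda>y::int. esum (\<lambda>t::int. ?e (y + (- (x1 - y1) - (x2 - y2)) + 3 * t + 2) y)))))))"
    by (simp only: C[symmetric])
  also have "\<dots> = ?S 0 + ?S 1 + ?S 2"
    by (simp only: esum_add[symmetric] distrib_left)
  finally have split: "ethC q ^ 3 = ?S 0 + ?S 1 + ?S 2" .
  have S0: "?S 0 = esum ?G"
  proof -
    let ?F = "\<lambda>(x1::int, y1::int, x2::int, y2::int, y3::int, t::int).
      epow q (A2form (x1 + 1/3) (y1 + 1/3) + A2form (x2 + 1/3) (y2 + 1/3) +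
        A2form ((y3 + (- (x1 - y1) - (x2 - y2)) + 3 * t + 0) + 1/3) (y3 + 1/3))"
    let ?g = "\<lambda>(x1::int, y1::int, x2::int, y2::int, y3::int, t::int).
      (y1 + y2 + y3 + 2 * t + 1, - t, x1 - y2 - t, x2 - y3 - t, - x1 + y1 - x2 + y3 + 2 * t, x1)"
    let ?h = "\<lambda>(a1::int, b1::int, a2::int, b2::int, b3::int, s::int).
      (s, b1 + b2 + b3 + s, a1 - b1 + a2 - b3 - 2 * s - 1, b1 - a2 + s, a1 + a2 - b2 - b3 - 2 * s - 1, - b1)"
    have "?S 0 = esum ?F"
      by (simp add: esum_cmult esum6 epow_add mult.assoc)
    also have "?F = (\<lambda>z. ?G (?g z))"
      by (rule ext, simp only: split_paired_all prod.case, rule arg_cong[where f = "epow q"])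
        (simp add: A2form_def field_simps power2_eq_square)
    also have "esum \<dots> = esum ?G"
      by (rule esum_reindex_inverse[where h = ?h]) auto
    finally show ?thesis .
  qed
  \<comment> \<open>The inverse \<open>?h\<close> agrees with the one for \<open>S0\<close> in its
    first four entries: only the third Eisenstein coordinate is multiplied by a power of \<omega>,
    which preserves the norm and the coset. The same holds for \<open>S2\<close>.\<close>
  have S1: "?S 1 = esum ?G"
  proof -
    let ?F = "\<lambda>(x1::int, y1::int, x2::int, y2::int, y3::int, t::int).
      epow q (A2form (x1 + 1/3) (y1 + 1/3) + A2form (x2 + 1/3) (y2 + 1/3) +
        A2form ((y3 + (- (x1 - y1) - (x2 - y2)) + 3 * t + 1) + 1/3) (y3 + 1/3))"
    let ?g = "\<lambda>(x1::int, y1::int, x2::int, y2::int, y3::int, t::int).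
      (x1 + x2 - y3 - t, - x1 + y1 - x2 + y2 + y3 + 2 * t + 1, y1 - x2 + y3 + 2 * t + 1, x2 - t, - y2 - y3 - t - 1, x1)"
    let ?h = "\<lambda>(a1::int, b1::int, a2::int, b2::int, b3::int, s::int).
      (s, b1 + b2 + b3 + s, a1 - b1 + a2 - b3 - 2 * s - 1, b1 - a2 + s, - a1 + b2 + s, a1 - b1 + a2 - b2 - b3 - 2 * s - 1)"
    have "?S 1 = esum ?F"
      by (simp add: esum_cmult esum6 epow_add mult.assoc)
    also have "?F = (\<lambda>z. ?G (?g z))"
      by (rule ext, simp only: split_paired_all prod.case, rule arg_cong[where f = "epow q"])
        (simp add: A2form_def field_simps power2_eq_square)
    also have "esum \<dots> = esum ?G"
      by (rule esum_reindex_inverse[where h = ?h]) auto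
    finally show ?thesis .
  qed
  have S2: "?S 2 = esum ?G"
  proof -
    let ?F = "\<lambda>(x1::int, y1::int, x2::int, y2::int, y3::int, t::int).
      epow q (A2form (x1 + 1/3) (y1 + 1/3) + A2form (x2 + 1/3) (y2 + 1/3) +
        A2form ((y3 + (- (x1 - y1) - (x2 - y2)) + 3 * t + 2) + 1/3) (y3 + 1/3))"
    let ?g = "\<lambda>(x1::int, y1::int, x2::int, y2::int, y3::int, t::int).
      (x1 + x2 - t, - y3 - t - 1, x1 - y2 - y3 - t - 1, - x1 + y1 + y2 + y3 + 2 * t + 2, - y2 - t - 1, x1)"
    let ?h = "\<lambda>(a1::int, b1::int, a2::int, b2::int, b3::int, s::int).
      (s, b1 + b2 + b3 + s, a1 - b1 + a2 - b3 - 2 * s - 1, b1 - a2 + s, - a2 + b3 + s, - b1 + a2 - b3 - s - 1)"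
    have "?S 2 = esum ?F"
      by (simp add: esum_cmult esum6 epow_add mult.assoc)
    also have "?F = (\<lambda>z. ?G (?g z))"
      by (rule ext, simp only: split_paired_all prod.case, rule arg_cong[where f = "epow q"])
        (simp add: A2form_def field_simps power2_eq_square)
    also have "esum \<dots> = esum ?G"
      by (rule esum_reindex_inverse[where h = ?h]) auto
    finally show ?thesis .
  qed
  have R: "?R = esum ?G"
  proof -
    have "?R = esum (\<lambda>x::int. esum (\<lambda>y::int. epow q (A2form x y) *
      esum (\<lambda>z::int. esum (\<lambda>u::int. epow q (A2form z u) *
        esum (\<lambda>v::int. esum (\<lambda>t::int. epow q (A2form (v + 3 * t + (1 - (x - y) - (z - u))) v)))))))"
      by (simp add: A2class_def)
    also have "\<dots> = esum ?G"
      by (simp add: esum_cmult esum6 epow_add mult.assoc)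
    finally show ?thesis .
  qed
  have triple: "c = s0 + s1 + s2 \<Longrightarrow> s0 = g \<Longrightarrow> s1 = g \<Longrightarrow> s2 = g \<Longrightarrow> r = g \<Longrightarrow> c = 3 * r"
    for c s0 s1 s2 g r :: ennreal
    by (simp only: times_numeral_unfold add.assoc)
  show ?thesis
    by (rule triple[OF split S0 S1 S2 R])
qed

lemma ethC_cube:
  "ethC q ^ 3 = 9 * (ethA (q powr 3) ^ 2 * ethC (q powr 3) + ethA (q powr 3) * ethC (q powr 3) ^ 2
     + ethC (q powr 3) ^ 3)"
  by (subst ethC_cube_eq_class_one, subst class_one_enumerator) (simp add: mult.assoc[symmetric])

section \<open>Real theta functions\<close>

definition theta3 :: "real \<Rightarrow> real" where
  "theta3 q = (\<Sum>\<^sub>\<infinity>n\<in>(UNIV :: int set). q powr ((of_int n)\<^sup>2))"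

definition theta2 :: "real \<Rightarrow> real" where
  "theta2 q = (\<Sum>\<^sub>\<infinity>n\<in>(UNIV :: int set). q powr ((of_int n + 1/2)\<^sup>2))"

lemma epow_mono: "0 < q \<Longrightarrow> q < 1 \<Longrightarrow> y \<le> x \<Longrightarrow> epow q x \<le> epow q y"
  unfolding epow_def by (intro ennreal_leI) (simp add: powr_le_cancel_iff powr_mono')

text \<open>\<open>int_decode\<close> lists the integers as 0, -1, 1, -2, ..., so its value n at
  \<open>k\<close> satisfies k/2 \<le> |n| \<le> n^2, and a geometric series of ratio
  \<open>sqrt q\<close> dominates.\<close>

lemma eth3_finite:
  assumes "0 < q" "q < 1"
  shows "eth3 q \<noteq> top"
proof -
  have "eth3 q = esum (\<lambda>k::nat. epow q ((int_decode k)\<^sup>2))"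
    using esum_reindex[OF bij_int_decode, of "\<lambda>n. epow q ((real_of_int n)\<^sup>2)"]
    by (simp add: eth3_def)
  also have "\<dots> \<le> esum (\<lambda>k::nat. ennreal (sqrt q ^ k))"
  proof (rule esum_mono)
    fix k :: nat
    define n where "n = int_decode k"
    have "real k / 2 \<le> \<bar>real_of_int n\<bar>"
      unfolding n_def int_decode_def by (cases "even k") (auto simp: sum_decode_def elim!: evenE oddE)
    also have "\<bar>real_of_int n\<bar> = real_of_int \<bar>n\<bar>" by simp
    also have "\<bar>n\<bar> \<le> n\<^sup>2"
      using self_le_power[of "\<bar>n\<bar>" 2] by (cases "n = 0") auto
    then have "real_of_int \<bar>n\<bar> \<le> (real_of_int n)\<^sup>2"
      by (metis of_int_le_iff of_int_power)
    finally have "epow q ((real_of_int n)\<^sup>2) \<le> epow q (real k / 2)"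
      by (intro epow_mono assms)
    also have "epow q (real k / 2) = ennreal (sqrt q ^ k)"
      using assms by (simp add: epow_def powr_half_sqrt[symmetric] powr_powr flip: powr_realpow)
    finally show "epow q ((int_decode k)\<^sup>2) \<le> ennreal (sqrt q ^ k)"
      by (simp add: n_def)
  qed
  also have "\<dots> < top"
    using assms
    by (simp add: esum_def nn_integral_count_space_nat suminf_ennreal2 summable_geometric ennreal_less_top)
  finally show ?thesis by simp
qed

text \<open>By \<open>eth3_split\<close> this series is a part of the finite
  \<open>eth3 (q powr (1/4))\<close>; \<open>ethC\<close> is later treated in the same way through
  \<open>ethA_split\<close>.\<close>

lemma eth2_finite:
  assumes "0 < q" "q < 1"
  shows "eth2 q \<noteq> top"
proof -
  have "eth3 (q powr (1/4)) = eth3 q + eth2 q"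
    using eth3_split[of "q powr (1/4)"] assms by (simp add: powr_powr)
  moreover have "eth3 (q powr (1/4)) \<noteq> top"
    using assms by (intro eth3_finite) (auto simp: powr01_less_one)
  ultimately show ?thesis by (auto simp: ennreal_add_eq_top)
qed

lemma A2form_ge: "A2form x y \<ge> (x\<^sup>2 + y\<^sup>2) / 2"
proof -
  have "2 * A2form x y - (x\<^sup>2 + y\<^sup>2) = (x + y)\<^sup>2"
    by (simp add: A2form_def power2_eq_square algebra_simps)
  then show ?thesis
    using zero_le_power2[of "x + y"] by (simp add: field_simps)
qed

lemma ethA_finite:
  assumes "0 < q" "q < 1"
  shows "ethA q \<noteq> top"
proof -
  have "ethA q \<le> esum (\<lambda>x::int. esum (\<lambda>y::int. epow q ((x\<^sup>2 + y\<^sup>2) / 2)))"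
    unfolding ethA_def using A2form_ge by (intro esum_mono epow_mono assms) auto
  also have "\<dots> = eth3 (q powr (1/2)) ^ 2"
    by (simp add: eth3_def power2_eq_square[of "esum _"] esum_product epow_powr epow_add add_divide_distrib)
  also have "eth3 (q powr (1/2)) \<noteq> top"
    using assms by (intro eth3_finite) (auto simp: powr01_less_one)
  then have "eth3 (q powr (1/2)) ^ 2 < top"
    by (simp add: power2_eq_square ennreal_mult_less_top less_top)
  finally show ?thesis by simp
qed

lemma ethC_finite:
  assumes "0 < q" "q < 1"
  shows "ethC q \<noteq> top"
proof -
  have "ethA (q powr (1/3)) = ethA q + 2 * ethC q"
    using ethA_split[of "q powr (1/3)"] assms by (simp add: powr_powr)
  moreover have "ethA (q powr (1/3)) \<noteq> top"
    using assms by (intro ethA_finite) (auto simp: powr01_less_one)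
  ultimately show ?thesis by (auto simp: ennreal_add_eq_top ennreal_mult_eq_top_iff)
qed

lemma theta3_nonneg: "theta3 q \<ge> 0" and theta2_nonneg: "theta2 q \<ge> 0"
  and cubic_theta_c_nonneg: "cubic_theta_c q \<ge> 0"
  unfolding theta3_def theta2_def cubic_theta_c_def by (intro infsum_nonneg; auto)+

lemma eth3_eq_theta3:
  assumes "0 < q" "q < 1"
  shows "eth3 q = ennreal (theta3 q)"
  using esum_ennreal[of "\<lambda>n::int. q powr ((of_int n)\<^sup>2)"] eth3_finite[OF assms]
  unfolding eth3_def epow_def theta3_def by simp

lemma eth2_eq_theta2:
  assumes "0 < q" "q < 1"
  shows "eth2 q = ennreal (theta2 q)"
  using esum_ennreal[of "\<lambda>n::int. q powr ((of_int n + 1/2)\<^sup>2)"] eth2_finite[OF assms]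
  unfolding eth2_def epow_def theta2_def by simp

lemma cubic_theta_a_powr:
  assumes "0 < q"
  shows "cubic_theta_a q = infsum (\<lambda>z::int\<times>int. q powr (A2form (of_int (fst z)) (of_int (snd z)))) UNIV"
  unfolding cubic_theta_a_def case_prod_unfold
proof (rule infsum_cong)
  fix z :: "int \<times> int"
  have "A2form (of_int (fst z)) (of_int (snd z)) = real_of_int ((fst z)\<^sup>2 + fst z * snd z + (snd z)\<^sup>2)"
    by (simp add: A2form_def)
  then show "q powi ((fst z)\<^sup>2 + fst z * snd z + (snd z)\<^sup>2) = q powr A2form (of_int (fst z)) (of_int (snd z))"
    using assms by (simp add: powr_real_of_int' del: of_int_add of_int_mult of_int_power)
qed

lemma cubic_theta_a_nonneg:
  assumes "0 < q"
  shows "cubic_theta_a q \<ge> 0"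
  unfolding cubic_theta_a_powr[OF assms] by (rule infsum_nonneg) auto

lemma ethA_eq_cubic_theta_a:
  assumes "0 < q" "q < 1"
  shows "ethA q = ennreal (cubic_theta_a q)"
  using esum_ennreal[of "\<lambda>z::int\<times>int. q powr (A2form (of_int (fst z)) (of_int (snd z)))"] ethA_finite[OF assms]
  unfolding ethA_def esum_pair epow_def cubic_theta_a_powr[OF assms(1)] by simp

lemma ethC_eq_cubic_theta_c:
  assumes "0 < q" "q < 1"
  shows "ethC q = ennreal (cubic_theta_c q)"
  using esum_ennreal[of "\<lambda>z::int\<times>int. q powr (A2form (of_int (fst z) + 1/3) (of_int (snd z) + 1/3))"] ethC_finite[OF assms]
  unfolding ethC_def esum_pair epow_def cubic_theta_c_def case_prod_unfold A2form_def by simp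

lemmas eth_eq = eth3_eq_theta3 eth2_eq_theta2 ethA_eq_cubic_theta_a ethC_eq_cubic_theta_c
lemmas theta_nonneg = theta3_nonneg theta2_nonneg cubic_theta_a_nonneg cubic_theta_c_nonneg

section \<open>Theta identities over the reals\<close>

lemma theta3_square:
  assumes "0 < q" "q < 1"
  shows "theta3 q ^ 2 = theta3 (q ^ 2) ^ 2 + theta2 (q ^ 2) ^ 2"
proof -
  have "ennreal (theta3 q ^ 2) = ennreal (theta3 (q ^ 2) ^ 2 + theta2 (q ^ 2) ^ 2)"
    using eth3_square[of q] assms
    by (simp add: eth_eq theta_nonneg power_less_one_iff flip: ennreal_power)
  then show ?thesis by (subst (asm) ennreal_inj) (simp_all add: theta_nonneg)
qed

lemma theta2_square:
  assumes "0 < q" "q < 1"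
  shows "theta2 q ^ 2 = 2 * theta2 (q ^ 2) * theta3 (q ^ 2)"
proof -
  have "ennreal (theta2 q ^ 2) = ennreal (2 * theta2 (q ^ 2) * theta3 (q ^ 2))"
    using eth2_square[of q] assms
    by (simp add: eth_eq theta_nonneg power_less_one_iff ennreal_mult flip: ennreal_power)
  then show ?thesis by (subst (asm) ennreal_inj) (simp_all add: theta_nonneg)
qed

lemma cubic_theta_a_split:
  assumes "0 < q" "q < 1"
  shows "cubic_theta_a q = cubic_theta_a (q ^ 3) + 2 * cubic_theta_c (q ^ 3)"
proof -
  have "ennreal (cubic_theta_a q) = ennreal (cubic_theta_a (q ^ 3) + 2 * cubic_theta_c (q ^ 3))"
    using ethA_split[of q] assms
    by (simp add: eth_eq theta_nonneg power_less_one_iff ennreal_mult)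
  then show ?thesis using assms by (subst (asm) ennreal_inj) (simp_all add: theta_nonneg)
qed

lemma cubic_theta_c_cube:
  assumes "0 < q" "q < 1"
  shows "cubic_theta_c q ^ 3 = 9 * (cubic_theta_a (q ^ 3) ^ 2 * cubic_theta_c (q ^ 3) +
    cubic_theta_a (q ^ 3) * cubic_theta_c (q ^ 3) ^ 2 + cubic_theta_c (q ^ 3) ^ 3)"
proof -
  have "ennreal (cubic_theta_c q ^ 3) = ennreal (9 * (cubic_theta_a (q ^ 3) ^ 2 * cubic_theta_c (q ^ 3) +
    cubic_theta_a (q ^ 3) * cubic_theta_c (q ^ 3) ^ 2 + cubic_theta_c (q ^ 3) ^ 3))"
    using ethC_cube[of q] assms
    by (simp add: eth_eq theta_nonneg power_less_one_iff ennreal_mult flip: ennreal_power)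
  then show ?thesis using assms by (subst (asm) ennreal_inj) (simp_all add: theta_nonneg)
qed

lemma cubic_theta_quartic:
  assumes "0 < q" "q < 1"
  shows "cubic_theta_a q ^ 4 + 8 * cubic_theta_a q * cubic_theta_c q ^ 3 =
    theta3 q ^ 8 + 14 * theta3 q ^ 4 * theta2 q ^ 4 + theta2 q ^ 8"
proof -
  have "ennreal (cubic_theta_a q ^ 4 + 8 * cubic_theta_a q * cubic_theta_c q ^ 3) =
    ennreal (theta3 q ^ 8 + 14 * theta3 q ^ 4 * theta2 q ^ 4 + theta2 q ^ 8)"
    using ethA_ethC_eq_eth3_eth2[of q] assms
    by (simp add: eth_eq theta_nonneg ennreal_mult flip: ennreal_power)
  then show ?thesis using assms by (subst (asm) ennreal_inj) (simp_all add: theta_nonneg)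
qed

section \<open>Size of the theta functions near q = 0\<close>

lemma esum_epow_le:
  assumes "0 < q" "q \<le> q0" "\<And>z. N z \<ge> d"
  shows "esum (\<lambda>z. epow q (N z)) \<le> ennreal ((q / q0) powr d) * esum (\<lambda>z. epow q0 (N z))"
  unfolding esum_cmult
proof (rule esum_mono)
  fix z
  \<comment> \<open>As q/q0 \<le> 1, its power decreases in the exponent, which is at least
    \<open>d\<close>. The series at a fixed \<open>q0\<close> thus controls the decay as q tends to
    0.\<close>
  have "q powr N z = (q / q0) powr N z * q0 powr N z"
    using assms by (simp add: powr_divide)
  also have "\<dots> \<le> (q / q0) powr d * q0 powr N z"
    using assms by (intro mult_right_mono powr_mono') auto
  finally show "epow q (N z) \<le> ennreal ((q / q0) powr d) * epow q0 (N z)"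
    by (simp add: epow_def ennreal_leI flip: ennreal_mult)
qed

lemma esum_epow_ge: "epow q (N z) \<le> esum (\<lambda>z. epow q (N z))"
  unfolding esum_def using nn_integral_ge_point[of z UNIV] by auto

text \<open>The vector of norm 0 is split off; every other exponent is at least 1, so the rest is of
  order q.\<close>

lemma esum_epow_le_1_plus:
  assumes "0 < q" "q \<le> q0" "N z0 = 0" "\<And>z. z \<noteq> z0 \<Longrightarrow> N z \<ge> 1"
  shows "esum (\<lambda>z. epow q (N z)) \<le> 1 + ennreal (q / q0) * esum (\<lambda>z. epow q0 (N z))"
proof -
  have one: "esum (indicator {z0} :: 'a \<Rightarrow> ennreal) = 1"
    unfolding esum_def by (subst nn_integral_indicator) auto
  have "esum (\<lambda>z. epow q (N z)) \<le> esum (\<lambda>z. indicator {z0} z + ennreal (q / q0) * epow q0 (N z))"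
  proof (rule esum_mono)
    fix z
    show "epow q (N z) \<le> indicator {z0} z + ennreal (q / q0) * epow q0 (N z)"
    proof (cases "z = z0")
      case True
      then show ?thesis
        using assms by (simp add: epow_def add_increasing2)
    next
      case False
      have "q powr N z = (q / q0) powr N z * q0 powr N z"
        using assms by (simp add: powr_divide)
      also have "\<dots> \<le> (q / q0) powr 1 * q0 powr N z"
        using assms(1,2) assms(4)[OF False] by (intro mult_right_mono powr_mono') auto
      finally show ?thesis
        using assms False by (simp add: epow_def ennreal_leI flip: ennreal_mult)
    qed
  qed
  also have "\<dots> = 1 + ennreal (q / q0) * esum (\<lambda>z. epow q0 (N z))"
    by (simp add: esum_add[symmetric] esum_cmult one)
  finally show ?thesis .
qed

lemma theta3_ge_1:
  assumes "0 < q" "q < 1"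
  shows "1 \<le> theta3 q"
  using esum_epow_ge[of q "\<lambda>n::int. (of_int n)\<^sup>2" 0] assms
  unfolding eth3_def[symmetric] eth_eq[OF assms] by (simp add: epow_def)

lemma theta3_le:
  assumes "0 < q" "q \<le> q0" "q0 < 1"
  shows "theta3 q \<le> 1 + q / q0 * theta3 q0"
proof -
  have "1 \<le> (real_of_int z)\<^sup>2" if "z \<noteq> 0" for z
  proof -
    have "0 < z\<^sup>2" using that by simp
    then have "1 \<le> real_of_int (z\<^sup>2)" by (simp only: of_int_1_le_iff)
    then show ?thesis by simp
  qed
  then have "eth3 q \<le> 1 + ennreal (q / q0) * eth3 q0"
    unfolding eth3_def using assms by (intro esum_epow_le_1_plus[where ?z0.0 = 0]) auto
  then have "ennreal (theta3 q) \<le> ennreal (1 + q / q0 * theta3 q0)"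
    using assms less_le_trans[of 0 q q0]
    by (simp add: eth_eq theta_nonneg flip: ennreal_mult)
  then show ?thesis
    using assms by (subst (asm) ennreal_le_iff) (simp_all add: theta_nonneg)
qed

lemma theta2_ge:
  assumes "0 < q" "q < 1"
  shows "q powr (1/4) \<le> theta2 q"
  using esum_epow_ge[of q "\<lambda>n::int. (of_int n + 1/2)\<^sup>2" 0] assms
  unfolding eth2_def[symmetric] eth_eq[OF assms]
  by (simp add: epow_def power2_eq_square theta_nonneg)

lemma theta2_le:
  assumes "0 < q" "q \<le> q0" "q0 < 1"
  shows "theta2 q \<le> (q / q0) powr (1/4) * theta2 q0"
proof -
  have "1/4 \<le> (real_of_int z + 1/2)\<^sup>2" for z
  proof -
    have "0 \<le> z * (z + 1)"
      by (cases "z \<ge> 0") (auto simp: zero_le_mult_iff)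
    then have "0 \<le> real_of_int (z * (z + 1))"
      by (simp only: of_int_0_le_iff)
    then show ?thesis by (simp add: power2_eq_square algebra_simps)
  qed
  then have "eth2 q \<le> ennreal ((q / q0) powr (1/4)) * eth2 q0"
    unfolding eth2_def using assms by (intro esum_epow_le) auto
  then have "ennreal (theta2 q) \<le> ennreal ((q / q0) powr (1/4) * theta2 q0)"
    using assms by (simp add: eth_eq ennreal_mult theta_nonneg)
  then show ?thesis
    using assms by (subst (asm) ennreal_le_iff) (simp_all add: theta_nonneg)
qed

lemma cubic_theta_a_ge_1:
  assumes "0 < q" "q < 1"
  shows "1 \<le> cubic_theta_a q"
  using esum_epow_ge[of q "\<lambda>z::int\<times>int. A2form (of_int (fst z)) (of_int (snd z))" "(0, 0)"] assms
  unfolding esum_pair[symmetric, of "\<lambda>x y. epow q (A2form (of_int x) (of_int y))"]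
    ethA_def[symmetric] eth_eq[OF assms]
  by (simp add: epow_def A2form_def)

lemma cubic_theta_a_le:
  assumes "0 < q" "q \<le> q0" "q0 < 1"
  shows "cubic_theta_a q \<le> 1 + q / q0 * cubic_theta_a q0"
proof -
  have "1 \<le> A2form (of_int (fst z)) (of_int (snd z))" if "z \<noteq> (0, 0)" for z :: "int \<times> int"
  proof -
    obtain x y where z: "z = (x, y)" by force
    have "0 < ((real_of_int x)\<^sup>2 + (real_of_int y)\<^sup>2) / 2"
      using that z by (auto simp: sum_power2_gt_zero_iff)
    also have "\<dots> \<le> A2form x y" by (rule A2form_ge)
    also have "\<dots> = real_of_int (x\<^sup>2 + x * y + y\<^sup>2)" by (simp add: A2form_def)
    finally have "1 \<le> x\<^sup>2 + x * y + y\<^sup>2" by (simp only: of_int_0_less_iff)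
    then have "1 \<le> real_of_int (x\<^sup>2 + x * y + y\<^sup>2)" by (simp only: of_int_1_le_iff)
    then show ?thesis by (simp add: A2form_def z)
  qed
  then have "ethA q \<le> 1 + ennreal (q / q0) * ethA q0"
    unfolding ethA_def esum_pair using assms
    by (intro esum_epow_le_1_plus[where ?z0.0 = "(0, 0)"]) (auto simp: A2form_def)
  then have "ennreal (cubic_theta_a q) \<le> ennreal (1 + q / q0 * cubic_theta_a q0)"
    using assms cubic_theta_a_nonneg[of q0] less_le_trans[of 0 q q0]
    by (simp add: eth_eq theta_nonneg flip: ennreal_mult)
  then show ?thesis
    using assms by (subst (asm) ennreal_le_iff) (simp_all add: theta_nonneg)
qed

lemma cubic_theta_c_pos:
  assumes "0 < q" "q < 1"
  shows "0 < cubic_theta_c q"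
proof -
  have "ennreal (q powr A2form (1/3) (1/3)) \<le> ethC q"
    using esum_epow_ge[of q "\<lambda>z::int\<times>int. A2form (of_int (fst z) + 1/3) (of_int (snd z) + 1/3)" "(0, 0)"]
    unfolding ethC_def esum_pair by (simp add: epow_def)
  then have "q powr A2form (1/3) (1/3) \<le> cubic_theta_c q"
    using assms by (simp add: eth_eq theta_nonneg)
  then show ?thesis
    using assms less_le_trans[of 0 "q powr A2form (1/3) (1/3)"] by simp
qed

lemma cubic_theta_c_le:
  assumes "0 < q" "q \<le> q0" "q0 < 1"
  shows "cubic_theta_c q \<le> (q / q0) powr (1/4) * cubic_theta_c q0"
proof -
  \<comment> \<open>The minimum on this coset is 1/3, attained at (0,0); the weaker 1/4 lets
    \<open>theta_tendsto\<close> use the same majorant as for \<open>theta2\<close>.\<close>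
  have "1/4 \<le> A2form (real_of_int x + 1/3) (real_of_int y + 1/3)" for x y
  proof -
    have *: "1/4 \<le> A2form (real_of_int u + 1/3) (real_of_int v + 1/3)" if "u \<noteq> 0" for u v
    proof -
      have "(2/3)\<^sup>2 \<le> (real_of_int u + 1/3)\<^sup>2"
        using that by (cases "u > 0") (auto intro!: power_mono simp: power2_le_iff_abs_le abs_le_square_iff[symmetric])
      then have "4/9 \<le> (real_of_int u + 1/3)\<^sup>2"
        by (simp add: power_divide)
      moreover have "4 * A2form (real_of_int u + 1/3) (real_of_int v + 1/3) =
          3 * (real_of_int u + 1/3)\<^sup>2 + (real_of_int u + 1/3 + 2 * (real_of_int v + 1/3))\<^sup>2"
        by (simp add: A2form_def power2_eq_square algebra_simps)
      moreover have "0 \<le> (real_of_int u + 1/3 + 2 * (real_of_int v + 1/3))\<^sup>2" by simp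
      ultimately show ?thesis by linarith
    qed
    show ?thesis
    proof (cases "x = 0 \<and> y = 0")
      case True
      then show ?thesis by (simp add: A2form_def power2_eq_square)
    next
      case False
      have "A2form (real_of_int x + 1/3) (real_of_int y + 1/3) =
          A2form (real_of_int y + 1/3) (real_of_int x + 1/3)"
        by (simp add: A2form_def)
      then show ?thesis using False *[of x y] *[of y x] by auto
    qed
  qed
  then have "ethC q \<le> ennreal ((q / q0) powr (1/4)) * ethC q0"
    unfolding ethC_def esum_pair using assms by (intro esum_epow_le) auto
  then have "ennreal (cubic_theta_c q) \<le> ennreal ((q / q0) powr (1/4) * cubic_theta_c q0)"
    using assms by (simp add: eth_eq ennreal_mult theta_nonneg)
  then show ?thesis
    using assms by (subst (asm) ennreal_le_iff) (simp_all add: theta_nonneg)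
qed

section \<open>Limits at 0 and invariance under q \<mapsto> q^k\<close>

lemma tendsto_at_right_0_sandwich:
  fixes f :: "real \<Rightarrow> real"
  assumes "\<And>q. 0 < q \<Longrightarrow> q \<le> 1/2 \<Longrightarrow> l \<le> f q \<and> f q \<le> h q" "(h \<longlongrightarrow> l) (at_right 0)"
  shows "(f \<longlongrightarrow> l) (at_right 0)"
proof -
  have ev: "eventually (\<lambda>q. 0 < q \<and> q \<le> 1/2) (at_right (0::real))"
    unfolding eventually_at_right_field by (rule exI[of _ "1/2"]) auto
  show ?thesis
    by (rule tendsto_sandwich[OF _ _ tendsto_const assms(2)]; rule eventually_mono[OF ev]; use assms(1) in blast)
qed

lemma theta_tendsto:
  "(theta3 \<longlongrightarrow> 1) (at_right 0)" "(theta2 \<longlongrightarrow> 0) (at_right 0)"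
  "(cubic_theta_a \<longlongrightarrow> 1) (at_right 0)" "(cubic_theta_c \<longlongrightarrow> 0) (at_right 0)"
proof -
  have 1: "((\<lambda>q. 1 + q / (1/2) * c) \<longlongrightarrow> 1) (at_right 0)" for c :: real
    by (rule tendsto_eq_intros refl | simp)+
  have 2: "((\<lambda>q. (q / (1/2)) powr (1/4) * c) \<longlongrightarrow> 0) (at_right 0)" for c :: real
  proof -
    have "((\<lambda>q. (q / (1/2)) powr (1/4) * c) \<longlongrightarrow> 0 powr (1/4) * c) (at_right (0::real))"
      by (intro tendsto_mult tendsto_powr' tendsto_const)
        (auto intro!: tendsto_eq_intros simp: eventually_at_right_field intro: exI[of _ 1])
    then show ?thesis by simp
  qed
  show "(theta3 \<longlongrightarrow> 1) (at_right 0)"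
    by (rule tendsto_at_right_0_sandwich[OF _ 1]) (use theta3_le[of _ "1/2"] theta3_ge_1 in auto)
  show "(theta2 \<longlongrightarrow> 0) (at_right 0)"
    by (rule tendsto_at_right_0_sandwich[OF _ 2]) (use theta2_le[of _ "1/2"] theta2_nonneg in auto)
  show "(cubic_theta_a \<longlongrightarrow> 1) (at_right 0)"
    by (rule tendsto_at_right_0_sandwich[OF _ 1]) (use cubic_theta_a_le[of _ "1/2"] cubic_theta_a_ge_1 in auto)
  show "(cubic_theta_c \<longlongrightarrow> 0) (at_right 0)"
    by (rule tendsto_at_right_0_sandwich[OF _ 2]) (use cubic_theta_c_le[of _ "1/2"] cubic_theta_c_nonneg in auto)
qed

lemma iterated_power_tendsto:
  fixes q :: real
  assumes "0 < q" "q < 1" "1 < k"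
  shows "filterlim (\<lambda>n. q ^ (k ^ n)) (at_right 0) sequentially"
proof -
  have "filterlim (\<lambda>n::nat. k ^ n) sequentially sequentially"
    using assms(3) by (intro filterlim_subseq) (auto intro!: strict_monoI)
  from filterlim_compose[OF LIMSEQ_realpow_zero this] assms
  have "(\<lambda>n. q ^ (k ^ n)) \<longlonglongrightarrow> 0" by auto
  then show ?thesis
    using assms by (auto simp: filterlim_at eventually_sequentially)
qed

lemma iterate_invariant:
  fixes f :: "real \<Rightarrow> 'b"
  assumes "\<And>q. 0 < q \<Longrightarrow> q < 1 \<Longrightarrow> f (q ^ k) = f q" "0 < q" "q < 1" "1 < k"
  shows "f (q ^ (k ^ n)) = f q"
proof (induction n)
  case (Suc n)
  have "f ((q ^ (k ^ n)) ^ k) = f (q ^ (k ^ n))"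
    using assms by (intro assms(1)) (auto simp: power_less_one_iff)
  then show ?case using Suc by (simp add: power_mult[symmetric] mult.commute)
qed simp

lemma invariant_eq_limit:
  fixes f :: "real \<Rightarrow> real"
  assumes "\<And>q. 0 < q \<Longrightarrow> q < 1 \<Longrightarrow> f (q ^ k) = f q" "0 < q" "q < 1" "1 < k" "(f \<longlongrightarrow> l) (at_right 0)"
  shows "f q = l"
proof -
  have "(\<lambda>n. f (q ^ (k ^ n))) \<longlonglongrightarrow> l"
    by (rule filterlim_compose[OF assms(5) iterated_power_tendsto[OF assms(2,3,4)]])
  moreover have "f (q ^ (k ^ n)) = f q" for n
    by (rule iterate_invariant[where f = f]) (use assms in auto)
  ultimately show ?thesis by (simp add: LIMSEQ_const_iff)
qed

section \<open>The hypergeometric functions and their transformations\<close>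

text \<open>One family for both functions: a = 1/3 is the cubic series, a = 1/2 is 2/\<pi> K. For
  these parameters the hypergeometric equation is (x(1-x)F')' = a(1-a)F.\<close>

definition ellF :: "real \<Rightarrow> real \<Rightarrow> real" where
  "ellF a x = hypergeo_2F1 a (1 - a) 1 x"

definition ellF_coeff :: "real \<Rightarrow> nat \<Rightarrow> real" where
  "ellF_coeff a n = pochhammer a n * pochhammer (1 - a) n / (fact n)\<^sup>2"

lemma ellF_eq_suminf: "ellF a x = (\<Sum>n. ellF_coeff a n * x ^ n)"
  by (simp add: ellF_def hypergeo_2F1_def ellF_coeff_def pochhammer_fact[symmetric] power2_eq_square
      divide_divide_eq_left mult.assoc)

lemma ellF_coeff_0: "ellF_coeff a 0 = 1"
  by (simp add: ellF_coeff_def)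

text \<open>The factorisation (a+n)(1-a+n) = n(n+1) + a(1-a) isolates the constant a(1-a) of the
  differential equation.\<close>

lemma ellF_coeff_Suc:
  "(real n + 1)\<^sup>2 * ellF_coeff a (Suc n) = (real n * (real n + 1) + a * (1 - a)) * ellF_coeff a n"
proof -
  have "(real n + 1)\<^sup>2 * ellF_coeff a (Suc n) =
      (a + real n) * (1 - a + real n) * (pochhammer a n * pochhammer (1 - a) n / (fact n)\<^sup>2)"
    by (simp add: ellF_coeff_def pochhammer_Suc power_mult_distrib add.commute) 
  then show ?thesis by (simp add: ellF_coeff_def algebra_simps)
qed

context
  fixes a :: real
  assumes a: "0 < a" "a < 1"
begin

lemma ellF_coeff_pos: "ellF_coeff a n > 0"
  using a by (simp add: ellF_coeff_def pochhammer_pos)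

lemma ellF_coeff_le_1: "ellF_coeff a n \<le> 1"
proof (induction n)
  case (Suc n)
  have "a * (1 - a) \<le> 1 * 1"
    using a by (intro mult_mono) auto
  then have "real n * (real n + 1) + a * (1 - a) \<le> (real n + 1)\<^sup>2"
    by (simp add: power2_eq_square algebra_simps)
  then have "(real n + 1)\<^sup>2 * ellF_coeff a (Suc n) \<le> (real n + 1)\<^sup>2 * ellF_coeff a n"
    using ellF_coeff_pos[of n] by (simp add: ellF_coeff_Suc mult_right_mono)
  then have "ellF_coeff a (Suc n) \<le> ellF_coeff a n"
    by (simp add: mult_le_cancel_left power2_eq_square)
  with Suc show ?case by simp
qed (simp add: ellF_coeff_0)

lemma summable_ellF:
  assumes "\<bar>x\<bar> < 1"
  shows "summable (\<lambda>n. ellF_coeff a n * x ^ n)"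
proof (rule summable_comparison_test'[where N = 0 and g = "\<lambda>n. \<bar>x\<bar> ^ n"])
  show "summable (\<lambda>n. \<bar>x\<bar> ^ n)"
    using assms by (simp add: summable_geometric)
  show "norm (ellF_coeff a n * x ^ n) \<le> \<bar>x\<bar> ^ n" for n
    using ellF_coeff_pos[of n] ellF_coeff_le_1[of n]
    by (simp add: abs_mult power_abs mult_left_le_one_le)
qed

definition "ellF' x = (\<Sum>n. diffs (ellF_coeff a) n * x ^ n)"

lemma ellF_has_derivative:
  assumes "\<bar>x\<bar> < 1"
  shows "(ellF a has_real_derivative ellF' x) (at x)"
proof -
  have "ellF a = (\<lambda>x. \<Sum>n. ellF_coeff a n * x ^ n)"
    by (simp add: ellF_eq_suminf fun_eq_iff)
  then show ?thesis
    unfolding ellF'_def using assms summable_ellF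
    by (simp only:) (rule termdiffs_strong'[where K = 1]; simp)
qed

text \<open>The hypergeometric differential equation in self-adjoint form.\<close>

lemma ellF_flux_has_derivative:
  assumes "\<bar>x\<bar> < 1"
  shows "((\<lambda>x. x * (1 - x) * ellF' x) has_real_derivative a * (1 - a) * ellF a x) (at x)"
proof -
  \<comment> \<open>\<open>e\<close> holds the coefficients of xF'. Subtracting its shift gives in
    \<open>g\<close> those of x(1-x)F'; the \<open>case\<close> makes the shifted sequence 0 at
    index 0.\<close>
  define e where "e n = real n * ellF_coeff a n" for n
  define g where "g n = e n - (case n of 0 \<Rightarrow> 0 | Suc m \<Rightarrow> e m)" for n
  have sums: "(\<lambda>n. g n * x ^ n) sums (x * (1 - x) * ellF' x)" if x: "\<bar>x\<bar> < 1" for x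
  proof -
    have "summable (\<lambda>n. diffs (ellF_coeff a) n * x ^ n)"
      by (rule termdiff_converges[where K = 1]) (use x summable_ellF in auto)
    then have "(\<lambda>n. diffs (ellF_coeff a) n * x ^ n) sums ellF' x"
      unfolding ellF'_def by (rule summable_sums)
    then have "(\<lambda>n. x * (diffs (ellF_coeff a) n * x ^ n)) sums (x * ellF' x)"
      by (rule sums_mult)
    then have "(\<lambda>n. e (Suc n) * x ^ Suc n) sums (x * ellF' x)"
      by (simp add: diffs_def e_def ac_simps)
    then have e: "(\<lambda>n. e n * x ^ n) sums (x * ellF' x)"
      using sums_Suc_iff[of "\<lambda>n. e n * x ^ n" "x * ellF' x"] by (simp add: e_def)
    from sums_mult[OF e, of x]
    have "(\<lambda>n. (case Suc n of 0 \<Rightarrow> 0 | Suc m \<Rightarrow> e m) * x ^ Suc n) sums (x * (x * ellF' x))"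
      by (simp add: ac_simps)
    then have "(\<lambda>n. (case n of 0 \<Rightarrow> 0 | Suc m \<Rightarrow> e m) * x ^ n) sums (x * (x * ellF' x))"
      using sums_Suc_iff[of "\<lambda>n. (case n of 0 \<Rightarrow> 0 | Suc m \<Rightarrow> e m) * x ^ n" "x * (x * ellF' x)"]
      by simp
    from sums_diff[OF e this] show ?thesis
      by (simp add: g_def algebra_simps)
  qed
  have "((\<lambda>x. \<Sum>n. g n * x ^ n) has_real_derivative (\<Sum>n. diffs g n * x ^ n)) (at x)"
    using assms sums by (intro termdiffs_strong'[where K = 1]) (auto simp: sums_iff)
  also have "(\<Sum>n. diffs g n * x ^ n) = (\<Sum>n. a * (1 - a) * (ellF_coeff a n * x ^ n))"
  proof (rule suminf_cong)
    fix n
    have "diffs g n = (real n + 1)\<^sup>2 * ellF_coeff a (Suc n) - real n * (real n + 1) * ellF_coeff a n"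
      by (simp add: diffs_def g_def e_def power2_eq_square algebra_simps)
    also have "\<dots> = a * (1 - a) * ellF_coeff a n"
      unfolding ellF_coeff_Suc by (simp add: algebra_simps)
    finally show "diffs g n * x ^ n = a * (1 - a) * (ellF_coeff a n * x ^ n)" by simp
  qed
  also have "\<dots> = a * (1 - a) * ellF a x"
    unfolding ellF_eq_suminf using assms by (intro suminf_mult summable_ellF)
  finally show ?thesis
  proof (rule has_field_derivative_transform_within_open[where S = "{-1<..<1}"])
    show "(\<Sum>n. g n * y ^ n) = y * (1 - y) * ellF' y" if "y \<in> {-1<..<1}" for y
      using that by (intro sums_unique[symmetric] sums) auto
  qed (use assms in auto)
qed

lemma ellF_ge_1:
  assumes "0 \<le> x" "x < 1"
  shows "ellF a x \<ge> 1"
  unfolding ellF_eq_suminf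
  using sum_le_suminf[OF summable_ellF, of x "{0}"] assms ellF_coeff_pos
  by (simp add: ellF_coeff_0 less_imp_le)

lemma ellF'_pos:
  assumes "0 \<le> x" "x < 1"
  shows "ellF' x > 0"
proof -
  have "summable (\<lambda>n. diffs (ellF_coeff a) n * x ^ n)"
    by (rule termdiff_converges[where K = 1]) (use assms summable_ellF in auto)
  from sum_le_suminf[OF this, of "{0}"] have "ellF_coeff a 1 \<le> ellF' x"
    using assms ellF_coeff_pos by (simp add: ellF'_def diffs_def less_imp_le)
  then show ?thesis using ellF_coeff_pos[of 1] by linarith
qed

lemma ellF_less:
  assumes "0 \<le> x" "x < y" "y < 1"
  shows "ellF a x < ellF a y"
proof (rule DERIV_pos_imp_increasing[where f = "ellF a"])
  show "x < y" by fact
  fix z assume "x \<le> z" "z \<le> y"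
  with assms have "0 \<le> z" "z < 1" by auto
  then show "\<exists>d. (ellF a has_real_derivative d) (at z) \<and> d > 0"
    using ellF_has_derivative[of z] ellF'_pos[of z] by auto
qed

end

lemma ellF_0: "ellF a 0 = 1"
  unfolding ellF_eq_suminf by (subst suminf_finite[of "{0}"]) (auto simp: ellF_coeff_0)

text \<open>The Wronskian \<open>u z - v y\<close> of two solutions is constant, and vanishes at the singular endpoint.\<close>

lemma sturm_liouville_unique:
  fixes y z u v dy dz P w :: "real \<Rightarrow> real"
  assumes cont: "continuous_on {0..<1} y" "continuous_on {0..<1} z"
      "continuous_on {0..<1} u" "continuous_on {0..<1} v"
    and der: "\<And>t. 0 < t \<Longrightarrow> t < 1 \<Longrightarrow> (y has_real_derivative dy t) (at t)"
      "\<And>t. 0 < t \<Longrightarrow> t < 1 \<Longrightarrow> (z has_real_derivative dz t) (at t)"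
      "\<And>t. 0 < t \<Longrightarrow> t < 1 \<Longrightarrow> (u has_real_derivative w t * y t) (at t)"
      "\<And>t. 0 < t \<Longrightarrow> t < 1 \<Longrightarrow> (v has_real_derivative w t * z t) (at t)"
    and flux: "\<And>t. 0 < t \<Longrightarrow> t < 1 \<Longrightarrow> P t \<noteq> 0"
      "\<And>t. 0 < t \<Longrightarrow> t < 1 \<Longrightarrow> u t = P t * dy t"
      "\<And>t. 0 < t \<Longrightarrow> t < 1 \<Longrightarrow> v t = P t * dz t"
    and zero: "u 0 = 0" "v 0 = 0"
    and pos: "\<And>t. 0 \<le> t \<Longrightarrow> t < 1 \<Longrightarrow> z t \<noteq> 0"
    and init: "y 0 = z 0" and t: "0 \<le> t" "t < 1"
  shows "y t = z t"
proof (cases "t = 0")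
  case False
  have sub: "continuous_on {0..s} f" if "continuous_on {0..<1} f" "s < 1" for f :: "real \<Rightarrow> real" and s
    using that by (rule_tac continuous_on_subset) auto
  have W: "u s * z s - v s * y s = 0" if s: "0 < s" "s < 1" for s
  proof -
    have "u s * z s - v s * y s = u 0 * z 0 - v 0 * y 0"
    proof (rule DERIV_isconst_end[OF s(1)])
      show "continuous_on {0..s} (\<lambda>s. u s * z s - v s * y s)"
        using cont s by (intro continuous_intros sub) auto
      fix x assume x: "0 < x" "x < s"
      then have "((\<lambda>s. u s * z s - v s * y s) has_real_derivative
          (w x * y x * z x + dz x * u x) - (w x * z x * y x + dy x * v x)) (at x)"
        using s by (intro derivative_intros der) auto
      moreover have "(w x * y x * z x + dz x * u x) - (w x * z x * y x + dy x * v x) = 0"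
        using x s by (simp add: flux)
      ultimately show "((\<lambda>s. u s * z s - v s * y s) has_real_derivative 0) (at x)" by simp
    qed
    then show ?thesis by (simp add: zero)
  qed
  \<comment> \<open>Dividing the vanishing Wronskian by P gives y'z = yz', so y/z is
    constant.\<close>
  have "y t / z t = y 0 / z 0"
  proof (rule DERIV_isconst_end[where f = "\<lambda>s. y s / z s"])
    show "0 < t" using t False by simp
    show "continuous_on {0..t} (\<lambda>s. y s / z s)"
      using cont t pos by (intro continuous_intros sub) auto
    fix x assume x: "0 < x" "x < t"
    then have "((\<lambda>s. y s / z s) has_real_derivative
        (dy x * z x - y x * dz x) / (z x * z x)) (at x)"
      using t pos by (intro DERIV_divide der) auto
    moreover have "P x * (dy x * z x - y x * dz x) = 0"
      using W[of x] flux(2,3)[of x] x t by (simp add: algebra_simps)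
    then have "dy x * z x - y x * dz x = 0"
      using flux(1)[of x] x t by simp
    ultimately show "((\<lambda>s. y s / z s) has_real_derivative 0) (at x)" by simp
  qed
  then show ?thesis using pos[of t] pos[of 0] t init by (simp add: field_simps)
qed (use init in simp)

lemma ellF_continuous:
  assumes "0 < a" "a < 1" "\<bar>x\<bar> < 1"
  shows "isCont (ellF a) x"
  using ellF_has_derivative[OF assms] by (rule DERIV_isCont)

text \<open>The cubic transformation of the Borweins. In the variable t = 1 - x both arguments,
  \<alpha> = 1 - (1-t)^3 and \<beta> = (t/(3-2t))^3, vanish at the singular point t = 0, where both
  sides are 1.\<close>

lemma ellF_cubic_transformation:
  assumes "0 < x" "x \<le> 1"
  shows "ellF (1/3) (1 - x ^ 3) = 3 / (1 + 2 * x) * ellF (1/3) (((1 - x) / (1 + 2 * x)) ^ 3)"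
proof -
  let ?F = "ellF (1/3)" and ?L = "ellF' (1/3)"
  let ?G = "\<lambda>x. x * (1 - x) * ?L x"
  let ?\<alpha> = "\<lambda>t::real. 1 - (1 - t) ^ 3" and ?\<beta> = "\<lambda>t::real. (t / (3 - 2 * t)) ^ 3"
  \<comment> \<open>\<open>?A\<close> is P\<mu>' for the multiplier \<mu> = 3/(3-2t) and the P
    chosen below: the part of P(\<mu>F(\<beta>))' that comes from differentiating \<mu>.\<close>
  let ?A = "\<lambda>t::real. 2 * (1 - t) * (3 * t - 3 * t\<^sup>2 + t ^ 3) / (3 - 2 * t)\<^sup>2"
  have \<alpha>: "\<bar>?\<alpha> t\<bar> < 1" if "0 \<le> t" "t < 1" for t
    using that power_le_one[of "1 - t" 3] by (auto simp: abs_if)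
  have \<beta>: "\<bar>?\<beta> t\<bar> < 1" "?\<beta> t \<ge> 0" if "0 \<le> t" "t < 1" for t
  proof -
    have "0 \<le> t / (3 - 2 * t)" "t / (3 - 2 * t) < 1"
      using that by (auto simp: field_simps)
    then have "?\<beta> t < 1" "?\<beta> t \<ge> 0"
      by (simp_all only: power_less_one_iff zero_le_power) simp
    then show "\<bar>?\<beta> t\<bar> < 1" "?\<beta> t \<ge> 0"
      by linarith+
  qed
  have d\<alpha>: "(?\<alpha> has_real_derivative 3 * (1 - t)\<^sup>2) (at t)" for t
    by (auto intro!: derivative_eq_intros)
  have ds: "((\<lambda>t::real. 3 - 2 * t) has_real_derivative - 2) (at t)" for t
    by (auto intro!: derivative_eq_intros)
  have ds2: "((\<lambda>t::real. (3 - 2 * t)\<^sup>2) has_real_derivative - 4 * (3 - 2 * t)) (at t)" for t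
    by (auto intro!: derivative_eq_intros)
  have d\<beta>: "(?\<beta> has_real_derivative 9 * t\<^sup>2 / (3 - 2 * t) ^ 4) (at t)" if "t < 1" for t
    by (rule DERIV_cong[OF DERIV_power[OF DERIV_divide[OF DERIV_ident ds]]])
      (use that in \<open>simp_all add: divide_simps\<close>, simp add: algebra_simps power_numeral_reduce)
  have dN: "((\<lambda>t::real. 2 * (1 - t) * (3 * t - 3 * t\<^sup>2 + t ^ 3)) has_real_derivative
      2 * (3 - 12 * t + 12 * t\<^sup>2 - 4 * t ^ 3)) (at t)" for t
    by (auto intro!: derivative_eq_intros simp: algebra_simps power_numeral_reduce)
  have dA: "(?A has_real_derivative 2 * (3 - 12 * t + 12 * t\<^sup>2 - 4 * t ^ 3) / (3 - 2 * t)\<^sup>2 +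
      8 * (1 - t) * (3 * t - 3 * t\<^sup>2 + t ^ 3) / (3 - 2 * t) ^ 3) (at t)" if "t < 1" for t
    by (rule DERIV_cong[OF DERIV_divide[OF dN ds2]])
      (use that in \<open>simp_all add: divide_simps\<close>, simp add: algebra_simps power_numeral_reduce)
  have d\<mu>: "((\<lambda>t::real. 3 / (3 - 2 * t)) has_real_derivative 6 / (3 - 2 * t)\<^sup>2) (at t)" if "t < 1" for t
    by (rule DERIV_cong[OF DERIV_divide[OF DERIV_const ds]])
      (use that in \<open>simp_all add: divide_simps power2_eq_square\<close>)
  have dF\<alpha>: "((\<lambda>t. ?F (?\<alpha> t)) has_real_derivative ?L (?\<alpha> t) * (3 * (1 - t)\<^sup>2)) (at t)"
    and dG\<alpha>: "((\<lambda>t. ?G (?\<alpha> t)) has_real_derivative (1/3) * (1 - 1/3) * ?F (?\<alpha> t) * (3 * (1 - t)\<^sup>2)) (at t)"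
    and dF\<beta>: "((\<lambda>t. ?F (?\<beta> t)) has_real_derivative ?L (?\<beta> t) * (9 * t\<^sup>2 / (3 - 2 * t) ^ 4)) (at t)"
    and dG\<beta>: "((\<lambda>t. ?G (?\<beta> t)) has_real_derivative (1/3) * (1 - 1/3) * ?F (?\<beta> t) * (9 * t\<^sup>2 / (3 - 2 * t) ^ 4)) (at t)"
    if t: "0 \<le> t" "t < 1" for t
    using \<alpha>[OF t] \<beta>[OF t] t
    by (intro DERIV_chain2[OF ellF_has_derivative d\<alpha>] DERIV_chain2[OF ellF_flux_has_derivative d\<alpha>]
        DERIV_chain2[OF ellF_has_derivative d\<beta>] DERIV_chain2[OF ellF_flux_has_derivative d\<beta>]; simp)+
  have main: "?F (?\<alpha> (1 - x)) = 3 / (3 - 2 * (1 - x)) * ?F (?\<beta> (1 - x))"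
  \<comment> \<open>P = \<alpha>(1-\<alpha>)/\<alpha>' and w = (2/9)\<alpha>' turn the equation in
    \<alpha> into (Py')' = wy in t. The work lies in showing that \<mu>F(\<beta>) solves it
    too.\<close>
  proof (rule sturm_liouville_unique[where y = "\<lambda>t. ?F (?\<alpha> t)" and u = "\<lambda>t. ?G (?\<alpha> t)"
      and z = "\<lambda>t. 3 / (3 - 2 * t) * ?F (?\<beta> t)"
      and v = "\<lambda>t. ?A t * ?F (?\<beta> t) + (3 - 2 * t) * ?G (?\<beta> t)"
      and P = "\<lambda>t. (1 - t) * (3 * t - 3 * t\<^sup>2 + t ^ 3) / 3"
      and w = "\<lambda>t. 2/3 * (1 - t)\<^sup>2"
      and dy = "\<lambda>t. ?L (?\<alpha> t) * (3 * (1 - t)\<^sup>2)"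
      and dz = "\<lambda>t. 6 / (3 - 2 * t)\<^sup>2 * ?F (?\<beta> t) + ?L (?\<beta> t) * (9 * t\<^sup>2 / (3 - 2 * t) ^ 4) * (3 / (3 - 2 * t))"])
    have dy2: "((\<lambda>t. 3 / (3 - 2 * t) * ?F (?\<beta> t)) has_real_derivative
        6 / (3 - 2 * t)\<^sup>2 * ?F (?\<beta> t) + ?L (?\<beta> t) * (9 * t\<^sup>2 / (3 - 2 * t) ^ 4) * (3 / (3 - 2 * t))) (at t)"
      if "0 \<le> t" "t < 1" for t
      using that by (intro DERIV_mult d\<mu> dF\<beta>)
    have du2: "((\<lambda>t. ?A t * ?F (?\<beta> t) + (3 - 2 * t) * ?G (?\<beta> t)) has_real_derivative
        2/3 * (1 - t)\<^sup>2 * (3 / (3 - 2 * t) * ?F (?\<beta> t))) (at t)" if t: "0 \<le> t" "t < 1" for t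
    proof -
      have der: "((\<lambda>t. ?A t * ?F (?\<beta> t) + (3 - 2 * t) * ?G (?\<beta> t)) has_real_derivative
          (2 * (3 - 12 * t + 12 * t\<^sup>2 - 4 * t ^ 3) / (3 - 2 * t)\<^sup>2 +
            8 * (1 - t) * (3 * t - 3 * t\<^sup>2 + t ^ 3) / (3 - 2 * t) ^ 3) * ?F (?\<beta> t) +
          ?L (?\<beta> t) * (9 * t\<^sup>2 / (3 - 2 * t) ^ 4) * ?A t +
          (- 2 * ?G (?\<beta> t) + (1/3) * (1 - 1/3) * ?F (?\<beta> t) * (9 * t\<^sup>2 / (3 - 2 * t) ^ 4) * (3 - 2 * t))) (at t)"
        using t by (intro DERIV_add DERIV_mult dA ds dF\<beta> dG\<beta>)
      \<comment> \<open>The terms with F' cancel because P\<mu>\<beta>' = (3-2t)\<beta>(1-\<beta>);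
        what remains is w\<mu>F(\<beta>).\<close>
      have L: "?L (?\<beta> t) * (9 * t\<^sup>2 / (3 - 2 * t) ^ 4) * ?A t = 2 * ?G (?\<beta> t)"
        using t by (simp add: divide_simps) (simp add: algebra_simps power_numeral_reduce)
      have F: "(2 * (3 - 12 * t + 12 * t\<^sup>2 - 4 * t ^ 3) / (3 - 2 * t)\<^sup>2 +
            8 * (1 - t) * (3 * t - 3 * t\<^sup>2 + t ^ 3) / (3 - 2 * t) ^ 3) * ?F (?\<beta> t) +
          (1/3) * (1 - 1/3) * ?F (?\<beta> t) * (9 * t\<^sup>2 / (3 - 2 * t) ^ 4) * (3 - 2 * t) =
          2/3 * (1 - t)\<^sup>2 * (3 / (3 - 2 * t) * ?F (?\<beta> t))"
        using t by (simp add: divide_simps) (simp add: algebra_simps power_numeral_reduce)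
      have combine: "a + l + (- 2 * g + f) = r" if "l = 2 * g" "a + f = r" for a l g f r :: real
        using that by simp
      show ?thesis
        by (rule DERIV_cong[OF der]) (rule combine[OF L F])
    qed
    show "continuous_on {0..<1} (\<lambda>t. ?F (?\<alpha> t))" "continuous_on {0..<1} (\<lambda>t. ?G (?\<alpha> t))"
      "continuous_on {0..<1} (\<lambda>t. 3 / (3 - 2 * t) * ?F (?\<beta> t))"
      "continuous_on {0..<1} (\<lambda>t. ?A t * ?F (?\<beta> t) + (3 - 2 * t) * ?G (?\<beta> t))"
      using dF\<alpha> dG\<alpha> dy2 du2 
      by (auto intro!: continuous_at_imp_continuous_on DERIV_isCont simp del: diff_mult_distrib)
    fix t :: real
    assume t: "0 < t" "t < 1"
    show "((\<lambda>t. ?F (?\<alpha> t)) has_real_derivative ?L (?\<alpha> t) * (3 * (1 - t)\<^sup>2)) (at t)"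
      "((\<lambda>t. 3 / (3 - 2 * t) * ?F (?\<beta> t)) has_real_derivative
        6 / (3 - 2 * t)\<^sup>2 * ?F (?\<beta> t) + ?L (?\<beta> t) * (9 * t\<^sup>2 / (3 - 2 * t) ^ 4) * (3 / (3 - 2 * t))) (at t)"
      "((\<lambda>t. ?A t * ?F (?\<beta> t) + (3 - 2 * t) * ?G (?\<beta> t)) has_real_derivative
        2/3 * (1 - t)\<^sup>2 * (3 / (3 - 2 * t) * ?F (?\<beta> t))) (at t)"
      using t by (intro dF\<alpha> dy2 du2; simp)+
    show "((\<lambda>t. ?G (?\<alpha> t)) has_real_derivative 2/3 * (1 - t)\<^sup>2 * ?F (?\<alpha> t)) (at t)"
      using dG\<alpha>[of t] t by (simp add: mult_ac)
    have "0 < 3 - 3 * t + t\<^sup>2" using t zero_le_power2[of t] by linarith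
    then have "0 < t * (3 - 3 * t + t\<^sup>2)" using t by simp
    then have "0 < 3 * t - 3 * t\<^sup>2 + t ^ 3" by (simp add: algebra_simps power_numeral_reduce)
    then show "(1 - t) * (3 * t - 3 * t\<^sup>2 + t ^ 3) / 3 \<noteq> 0" using t by simp
    show "?G (?\<alpha> t) = (1 - t) * (3 * t - 3 * t\<^sup>2 + t ^ 3) / 3 * (?L (?\<alpha> t) * (3 * (1 - t)\<^sup>2))"
    proof -
      have "?\<alpha> t * (1 - ?\<alpha> t) = (1 - t) * (3 * t - 3 * t\<^sup>2 + t ^ 3) / 3 * (3 * (1 - t)\<^sup>2)"
        by (simp add: algebra_simps power_numeral_reduce)
      then show ?thesis by (simp only: mult_ac)
    qed
    show "?A t * ?F (?\<beta> t) + (3 - 2 * t) * ?G (?\<beta> t) = (1 - t) * (3 * t - 3 * t\<^sup>2 + t ^ 3) / 3 *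
        (6 / (3 - 2 * t)\<^sup>2 * ?F (?\<beta> t) + ?L (?\<beta> t) * (9 * t\<^sup>2 / (3 - 2 * t) ^ 4) * (3 / (3 - 2 * t)))"
      using t by (simp add: divide_simps) (simp add: algebra_simps power_numeral_reduce)
  next
    fix t :: real assume "0 \<le> t" "t < 1"
    then show "3 / (3 - 2 * t) * ?F (?\<beta> t) \<noteq> 0"
      using ellF_ge_1[of "1/3" "?\<beta> t"] \<beta>[of t] by auto
  qed (use assms in \<open>simp_all add: ellF_0\<close>)
  have "3 - 2 * (1 - x) = 1 + 2 * x" by simp
  with main show ?thesis by simp
qed

text \<open>The same method with \<alpha> = 4t/(1+t)^2: now P = \<alpha>(1-\<alpha>)/\<alpha>' =
  t(1-t)/(1+t) and w = \<alpha>'/4, and (1+t)F(t^2) is checked to solve (Py')' = wy.\<close>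

lemma ellF_Landen:
  assumes "0 \<le> x" "x < 1"
  shows "ellF (1/2) (4 * x / (1 + x)\<^sup>2) = (1 + x) * ellF (1/2) (x\<^sup>2)"
proof -
  let ?F = "ellF (1/2)" and ?L = "ellF' (1/2)"
  let ?G = "\<lambda>x. x * (1 - x) * ?L x"
  let ?\<alpha> = "\<lambda>t::real. 4 * t / (1 + t)\<^sup>2" and ?\<beta> = "\<lambda>t::real. t\<^sup>2"
  let ?P = "\<lambda>t::real. t * (1 - t) / (1 + t)"
  have \<alpha>: "\<bar>?\<alpha> t\<bar> < 1" if t: "0 \<le> t" "t < 1" for t
  proof -
    have "(1 + t)\<^sup>2 = 4 * t + (1 - t)\<^sup>2" by (simp add: power2_eq_square algebra_simps)
    moreover have "(1 - t)\<^sup>2 > 0" using t by simp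
    ultimately have "4 * t < (1 + t)\<^sup>2" by linarith
    then show ?thesis using t by simp
  qed
  have \<beta>: "\<bar>?\<beta> t\<bar> < 1" if "0 \<le> t" "t < 1" for t
    using that by (simp add: power_less_one_iff)
  have d\<mu>: "((\<lambda>t::real. 1 + t) has_real_derivative 1) (at t)" for t
    by (auto intro!: derivative_eq_intros)
  have d\<mu>2: "((\<lambda>t::real. (1 + t)\<^sup>2) has_real_derivative 2 * (1 + t)) (at t)" for t
    by (auto intro!: derivative_eq_intros)
  have d4: "((\<lambda>t::real. 4 * t) has_real_derivative 4) (at t)" for t
    by (auto intro!: derivative_eq_intros)
  have d\<alpha>: "(?\<alpha> has_real_derivative 4 * (1 - t) / (1 + t) ^ 3) (at t)" if "0 \<le> t" for t
    by (rule DERIV_cong[OF DERIV_divide[OF d4 d\<mu>2]])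
      (use that in \<open>simp_all add: divide_simps\<close>, simp add: algebra_simps power_numeral_reduce)
  have d\<beta>: "(?\<beta> has_real_derivative 2 * t) (at t)" for t
    by (auto intro!: derivative_eq_intros)
  have dN: "((\<lambda>t::real. t * (1 - t)) has_real_derivative 1 - 2 * t) (at t)" for t
    by (auto intro!: derivative_eq_intros)
  have dP: "(?P has_real_derivative (1 - 2 * t - t\<^sup>2) / (1 + t)\<^sup>2) (at t)" if "0 \<le> t" for t
    by (rule DERIV_cong[OF DERIV_divide[OF dN d\<mu>]])
      (use that in \<open>simp_all add: divide_simps\<close>, simp add: algebra_simps power_numeral_reduce)
  have d\<nu>: "((\<lambda>t::real. 2 / (1 + t)) has_real_derivative - 2 / (1 + t)\<^sup>2) (at t)" if "0 \<le> t" for t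
    by (rule DERIV_cong[OF DERIV_divide[OF DERIV_const d\<mu>]])
      (use that in \<open>simp_all add: divide_simps power2_eq_square\<close>)
  have dF\<alpha>: "((\<lambda>t. ?F (?\<alpha> t)) has_real_derivative ?L (?\<alpha> t) * (4 * (1 - t) / (1 + t) ^ 3)) (at t)"
    and dG\<alpha>: "((\<lambda>t. ?G (?\<alpha> t)) has_real_derivative (1/2) * (1 - 1/2) * ?F (?\<alpha> t) * (4 * (1 - t) / (1 + t) ^ 3)) (at t)"
    and dF\<beta>: "((\<lambda>t. ?F (?\<beta> t)) has_real_derivative ?L (?\<beta> t) * (2 * t)) (at t)"
    and dG\<beta>: "((\<lambda>t. ?G (?\<beta> t)) has_real_derivative (1/2) * (1 - 1/2) * ?F (?\<beta> t) * (2 * t)) (at t)"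
    if t: "0 \<le> t" "t < 1" for t
    using \<alpha>[OF t] \<beta>[OF t] t
    by (intro DERIV_chain2[OF ellF_has_derivative d\<alpha>] DERIV_chain2[OF ellF_flux_has_derivative d\<alpha>]
        DERIV_chain2[OF ellF_has_derivative d\<beta>] DERIV_chain2[OF ellF_flux_has_derivative d\<beta>]; simp)+
  show ?thesis
  proof (rule sturm_liouville_unique[where y = "\<lambda>t. ?F (?\<alpha> t)" and u = "\<lambda>t. ?G (?\<alpha> t)"
      and z = "\<lambda>t. (1 + t) * ?F (?\<beta> t)"
      and v = "\<lambda>t. ?P t * ?F (?\<beta> t) + 2 / (1 + t) * ?G (?\<beta> t)"
      and P = ?P
      and w = "\<lambda>t. (1 - t) / (1 + t) ^ 3"
      and dy = "\<lambda>t. ?L (?\<alpha> t) * (4 * (1 - t) / (1 + t) ^ 3)"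
      and dz = "\<lambda>t. 1 * ?F (?\<beta> t) + ?L (?\<beta> t) * (2 * t) * (1 + t)"])
    have dy2: "((\<lambda>t. (1 + t) * ?F (?\<beta> t)) has_real_derivative
        1 * ?F (?\<beta> t) + ?L (?\<beta> t) * (2 * t) * (1 + t)) (at t)"
      if "0 \<le> t" "t < 1" for t
      using that by (intro DERIV_mult d\<mu> dF\<beta>)
    have du2: "((\<lambda>t. ?P t * ?F (?\<beta> t) + 2 / (1 + t) * ?G (?\<beta> t)) has_real_derivative
        (1 - t) / (1 + t) ^ 3 * ((1 + t) * ?F (?\<beta> t))) (at t)" if t: "0 \<le> t" "t < 1" for t
    proof -
      have "((\<lambda>t. ?P t * ?F (?\<beta> t) + 2 / (1 + t) * ?G (?\<beta> t)) has_real_derivative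
          (1 - 2 * t - t\<^sup>2) / (1 + t)\<^sup>2 * ?F (?\<beta> t) + ?L (?\<beta> t) * (2 * t) * ?P t +
          (- 2 / (1 + t)\<^sup>2 * ?G (?\<beta> t) + (1/2) * (1 - 1/2) * ?F (?\<beta> t) * (2 * t) * (2 / (1 + t)))) (at t)"
        using t by (intro DERIV_add DERIV_mult dP d\<nu> dF\<beta> dG\<beta>)
      moreover have "(1 - 2 * t - t\<^sup>2) / (1 + t)\<^sup>2 * ?F (?\<beta> t) + ?L (?\<beta> t) * (2 * t) * ?P t +
          (- 2 / (1 + t)\<^sup>2 * ?G (?\<beta> t) + (1/2) * (1 - 1/2) * ?F (?\<beta> t) * (2 * t) * (2 / (1 + t))) =
          (1 - t) / (1 + t) ^ 3 * ((1 + t) * ?F (?\<beta> t))"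
        using t by (simp add: divide_simps) (simp add: algebra_simps power_numeral_reduce)
      ultimately show ?thesis by (simp only:)
    qed
    show "continuous_on {0..<1} (\<lambda>t. ?F (?\<alpha> t))" "continuous_on {0..<1} (\<lambda>t. ?G (?\<alpha> t))"
      "continuous_on {0..<1} (\<lambda>t. (1 + t) * ?F (?\<beta> t))"
      "continuous_on {0..<1} (\<lambda>t. ?P t * ?F (?\<beta> t) + 2 / (1 + t) * ?G (?\<beta> t))"
      using dF\<alpha> dG\<alpha> dy2 du2
      by (auto intro!: continuous_at_imp_continuous_on DERIV_isCont)
    fix t :: real
    assume t: "0 < t" "t < 1"
    show "((\<lambda>t. ?F (?\<alpha> t)) has_real_derivative ?L (?\<alpha> t) * (4 * (1 - t) / (1 + t) ^ 3)) (at t)"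
      "((\<lambda>t. (1 + t) * ?F (?\<beta> t)) has_real_derivative
        1 * ?F (?\<beta> t) + ?L (?\<beta> t) * (2 * t) * (1 + t)) (at t)"
      "((\<lambda>t. ?P t * ?F (?\<beta> t) + 2 / (1 + t) * ?G (?\<beta> t)) has_real_derivative
        (1 - t) / (1 + t) ^ 3 * ((1 + t) * ?F (?\<beta> t))) (at t)"
      using t by (intro dF\<alpha> dy2 du2; simp)+
    show "((\<lambda>t. ?G (?\<alpha> t)) has_real_derivative (1 - t) / (1 + t) ^ 3 * ?F (?\<alpha> t)) (at t)"
      by (rule DERIV_cong[OF dG\<alpha>]) (use t in \<open>simp_all add: field_simps\<close>)
    show "?P t \<noteq> 0" using t by simp
    show "?G (?\<alpha> t) = ?P t * (?L (?\<alpha> t) * (4 * (1 - t) / (1 + t) ^ 3))"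
    proof -
      have "?\<alpha> t * (1 - ?\<alpha> t) = ?P t * (4 * (1 - t) / (1 + t) ^ 3)"
        using t by (simp add: divide_simps) (simp add: algebra_simps power_numeral_reduce)
      then show ?thesis by (simp only: mult_ac)
    qed
    show "?P t * ?F (?\<beta> t) + 2 / (1 + t) * ?G (?\<beta> t) =
        ?P t * (1 * ?F (?\<beta> t) + ?L (?\<beta> t) * (2 * t) * (1 + t))"
      using t by (simp add: divide_simps) (simp add: algebra_simps power_numeral_reduce)
  next
    fix t :: real assume "0 \<le> t" "t < 1"
    then show "(1 + t) * ?F (?\<beta> t) \<noteq> 0"
      using ellF_ge_1[of "1/2" "?\<beta> t"] \<beta>[of t] by auto
  qed (use assms in \<open>simp_all add: ellF_0\<close>)
qed

section \<open>The complete elliptic integral\<close>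

text \<open>The function sin^(2n+1) cos vanishes at both ends, so integrating its derivative gives
  the recursion (2n+2) I(n+1) = (2n+1) I(n).\<close>

lemma wallis_integral:
  "((\<lambda>t. sin t ^ (2 * n)) has_integral pi / 2 * (pochhammer (1/2) n / fact n)) {0..pi/2::real}"
proof (induction n)
  case 0
  show ?case
    using has_integral_const_real[of "1::real" 0 "pi/2"] by simp
next
  case (Suc n)
  have "((\<lambda>t::real. real (2 * n + 1) * sin t ^ (2 * n) - real (2 * n + 2) * sin t ^ (2 * Suc n)) has_integral
      sin (pi/2) ^ (2 * n + 1) * cos (pi/2) - sin 0 ^ (2 * n + 1) * cos 0) {0..pi/2}"
  proof (rule fundamental_theorem_of_calculus)
    fix t :: real
    have "((\<lambda>t. sin t ^ Suc (2 * n) * cos t) has_real_derivative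
        ((1 + real (2 * n)) * (cos t * sin t ^ (2 * n))) * cos t + (- sin t) * sin t ^ Suc (2 * n)) (at t within {0..pi/2})"
      by (intro DERIV_mult DERIV_power_Suc has_field_derivative_at_within[OF DERIV_sin]
          has_field_derivative_at_within[OF DERIV_cos])
    moreover have "((1 + real (2 * n)) * (cos t * sin t ^ (2 * n))) * cos t + (- sin t) * sin t ^ Suc (2 * n) =
        (1 + real (2 * n)) * sin t ^ (2 * n) * (cos t)\<^sup>2 - sin t ^ (2 * n) * (sin t)\<^sup>2"
      by (simp add: power2_eq_square)
    moreover have "\<dots> = real (2 * n + 1) * sin t ^ (2 * n) - real (2 * n + 2) * sin t ^ (2 * Suc n)"
      unfolding cos_squared_eq by (simp add: power2_eq_square algebra_simps)
    ultimately show "((\<lambda>t. sin t ^ (2 * n + 1) * cos t) has_vector_derivative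
        real (2 * n + 1) * sin t ^ (2 * n) - real (2 * n + 2) * sin t ^ (2 * Suc n)) (at t within {0..pi/2})"
      by (simp add: has_real_derivative_iff_has_vector_derivative)
  qed auto
  from has_integral_diff[OF has_integral_mult_right[OF Suc, of "real (2 * n + 1)"] this]
  have "((\<lambda>t::real. real (2 * n + 2) * sin t ^ (2 * Suc n)) has_integral
      real (2 * n + 1) * (pi / 2 * (pochhammer (1/2) n / fact n))) {0..pi/2}"
    by simp
  from has_integral_mult_right[OF this, of "1 / real (2 * n + 2)"]
  have "((\<lambda>t::real. sin t ^ (2 * Suc n)) has_integral
      1 / real (2 * n + 2) * (real (2 * n + 1) * (pi / 2 * (pochhammer (1/2) n / fact n)))) {0..pi/2}"
    by (simp del: of_nat_Suc of_nat_add of_nat_mult)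
  also have "1 / real (2 * n + 2) * (real (2 * n + 1) * (pi / 2 * (pochhammer (1/2) n / fact n))) =
      pi / 2 * (pochhammer (1/2) (Suc n) / fact (Suc n))"
    by (simp add: pochhammer_Suc divide_simps)
  finally show ?case .
qed

lemma inverse_sqrt_series:
  fixes z :: real
  assumes "\<bar>z\<bar> < 1"
  shows "(\<lambda>n. pochhammer (1/2) n / fact n * z ^ n) sums (1 / sqrt (1 - z))"
proof -
  have "(\<lambda>n. ((- 1/2) gchoose n) * (- z) ^ n) sums (1 + (- z)) powr (- 1/2)"
    by (rule gen_binomial_real) (use assms in simp)
  moreover have "((- 1/2) gchoose n) * (- z) ^ n = pochhammer (1/2) n / fact n * z ^ n" for n
  proof -
    have "(- 1 :: real) ^ n * (- z) ^ n = z ^ n"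
      by (simp flip: power_mult_distrib)
    then show ?thesis by (simp add: gbinomial_pochhammer)
  qed
  moreover have "(1 + (- z)) powr (- 1/2) = 1 / sqrt (1 - z)"
    using assms by (simp add: powr_minus_divide powr_half_sqrt)
  ultimately show ?thesis by simp
qed

text \<open>The binomial series of the integrand has coefficients (1/2)_n/n! between 0 and 1, so it
  converges uniformly by comparison with m^n. Termwise integration by \<open>wallis_integral\<close>
  supplies the second factor (1/2)_n/n!.\<close>

lemma elliptic_K_eq_ellF:
  assumes "0 \<le> m" "m < 1"
  shows "elliptic_K m = pi / 2 * ellF (1/2) m"
proof -
  let ?c = "\<lambda>n. pochhammer (1/2) n / fact n :: real"
  have c: "0 \<le> ?c n" "?c n \<le> 1" for n
  proof -
    show "0 \<le> ?c n" by (simp add: pochhammer_nonneg)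
    have "pochhammer (1/2 :: real) n \<le> pochhammer 1 n"
      unfolding pochhammer_prod by (intro prod_mono) auto
    then show "?c n \<le> 1" by (simp add: pochhammer_fact[symmetric])
  qed
  have unif: "uniform_limit {0..pi/2} (\<lambda>n t. \<Sum>k<n. ?c k * (m * (sin t)\<^sup>2) ^ k)
      (\<lambda>t. \<Sum>k. ?c k * (m * (sin t)\<^sup>2) ^ k) sequentially"
  proof (rule Weierstrass_m_test)
    show "summable (\<lambda>n. m ^ n)" using assms by (simp add: summable_geometric)
    fix n and t :: real
    have "(m * (sin t)\<^sup>2) ^ n \<le> m ^ n"
      using assms by (intro power_mono mult_right_le_one_le) (auto simp: abs_square_le_1)
    then have "?c n * (m * (sin t)\<^sup>2) ^ n \<le> 1 * m ^ n"
      using assms c by (intro mult_mono) auto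
    moreover have "0 \<le> ?c n * (m * (sin t)\<^sup>2) ^ n"
      using assms c[of n] by (intro mult_nonneg_nonneg) auto
    ultimately show "norm (?c n * (m * (sin t)\<^sup>2) ^ n) \<le> m ^ n"
      by (simp only: real_norm_def abs_of_nonneg mult_1)
  qed
  have part: "((\<lambda>t. \<Sum>k<n. ?c k * (m * (sin t)\<^sup>2) ^ k) has_integral
      (\<Sum>k<n. pi / 2 * (ellF_coeff (1/2) k * m ^ k))) {0..pi/2}" for n
  proof (rule has_integral_sum)
    fix k assume "k \<in> {..<n}"
    have eq: "?c k * (m * (sin t)\<^sup>2) ^ k = ?c k * m ^ k * sin t ^ (2 * k)" for t
      unfolding power_mult power_mult_distrib by simp
    from has_integral_mult_right[OF wallis_integral[of k], of "?c k * m ^ k"]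
    show "((\<lambda>t. ?c k * (m * (sin t)\<^sup>2) ^ k) has_integral pi / 2 * (ellF_coeff (1/2) k * m ^ k)) {0..pi/2}"
      unfolding eq by (simp add: ellF_coeff_def power2_eq_square[of "fact k"] mult_ac)
  qed simp
  have lim: "(\<lambda>n. \<Sum>k<n. pi / 2 * (ellF_coeff (1/2) k * m ^ k)) \<longlonglongrightarrow>
      integral {0..pi/2} (\<lambda>t. \<Sum>k. ?c k * (m * (sin t)\<^sup>2) ^ k)"
  proof (rule uniform_limit_integral_cbox)
    show "uniform_limit (cbox 0 (pi/2)) (\<lambda>n t. \<Sum>k<n. ?c k * (m * (sin t)\<^sup>2) ^ k)
        (\<lambda>t. \<Sum>k. ?c k * (m * (sin t)\<^sup>2) ^ k) sequentially"
      using unif by simp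
    show "continuous_on (cbox 0 (pi/2)) (\<lambda>t. \<Sum>k<n. ?c k * (m * (sin t)\<^sup>2) ^ k)" for n
      by (intro continuous_intros)
    fix I J
    assume I: "\<And>n. ((\<lambda>t. \<Sum>k<n. ?c k * (m * (sin t)\<^sup>2) ^ k) has_integral I n) (cbox 0 (pi/2))"
      and J: "((\<lambda>t. \<Sum>k. ?c k * (m * (sin t)\<^sup>2) ^ k) has_integral J) (cbox 0 (pi/2))"
      and lim: "I \<longlonglongrightarrow> J"
    have I': "I = (\<lambda>n. \<Sum>k<n. pi / 2 * (ellF_coeff (1/2) k * m ^ k))"
      by (rule ext, rule has_integral_unique[OF I part[folded box_real(2)]])
    show ?thesis
      using lim unfolding I' integral_unique[OF J[unfolded box_real(2)]] .
  qed simp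
  have int: "integral {0..pi/2} (\<lambda>t. \<Sum>k. ?c k * (m * (sin t)\<^sup>2) ^ k) = elliptic_K m"
    unfolding elliptic_K_def
  proof (rule integral_cong)
    fix t :: real
    have "m * (sin t)\<^sup>2 \<le> m" using assms by (intro mult_right_le_one_le) (auto simp: abs_square_le_1)
    then have "\<bar>m * (sin t)\<^sup>2\<bar> < 1" using assms by simp
    from inverse_sqrt_series[OF this]
    show "(\<Sum>k. ?c k * (m * (sin t)\<^sup>2) ^ k) = 1 / sqrt (1 - m * (sin t)\<^sup>2)"
      by (simp add: sums_iff)
  qed
  have "(\<lambda>n. \<Sum>k<n. pi / 2 * (ellF_coeff (1/2) k * m ^ k)) \<longlonglongrightarrow> pi / 2 * ellF (1/2) m"
    using summable_sums[OF summable_ellF[of "1/2" m]] assms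
    unfolding ellF_eq_suminf sums_def sum_distrib_left[symmetric] by (intro tendsto_mult) auto
  from LIMSEQ_unique[OF lim this] show ?thesis
    unfolding int .
qed

lemma elliptic_K_pos: "0 \<le> m \<Longrightarrow> m < 1 \<Longrightarrow> elliptic_K m > 0"
  using ellF_ge_1[of "1/2" m] by (simp add: elliptic_K_eq_ellF)

lemma elliptic_K_less: "0 \<le> m \<Longrightarrow> m < m' \<Longrightarrow> m' < 1 \<Longrightarrow> elliptic_K m < elliptic_K m'"
  using ellF_less[of "1/2" m m'] by (simp add: elliptic_K_eq_ellF)

lemma elliptic_K_complement_has_integral:
  assumes "0 < m" "m \<le> 1"
  shows "((\<lambda>t. 1 / sqrt (m + (1 - m) * (cos t)\<^sup>2)) has_integral elliptic_K (1 - m)) {0..pi/2}"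
proof -
  have eq: "1 - (1 - m) * (sin t)\<^sup>2 = m + (1 - m) * (cos t)\<^sup>2" for t
    unfolding cos_squared_eq by (simp add: algebra_simps)
  have "m + (1 - m) * (cos t)\<^sup>2 > 0" for t
    using assms by (intro add_pos_nonneg) auto
  then have "continuous_on {0..pi/2} (\<lambda>t. 1 / sqrt (m + (1 - m) * (cos t)\<^sup>2))"
    by (intro continuous_intros) (auto simp: less_imp_neq[symmetric])
  then have "(\<lambda>t. 1 / sqrt (m + (1 - m) * (cos t)\<^sup>2)) integrable_on {0..pi/2}"
    by (rule integrable_continuous_real)
  then show ?thesis
    unfolding elliptic_K_def eq by (rule integrable_integral)
qed

text \<open>With sin t in place of 1 in the numerator the integral is elementary. The case k = 1
  bounds K(1-m) from below; k = \<open>sqrt (1 - m)\<close> bounds it from above up to an error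
  \<pi>/(2k).\<close>

lemma has_integral_sin_over_sqrt:
  assumes "0 < m" "0 < k"
  shows "((\<lambda>t. sin t / sqrt (m + k\<^sup>2 * (cos t)\<^sup>2)) has_integral arsinh (k / sqrt m) / k) {0..pi/2}"
proof -
  have "((\<lambda>t. sin t / sqrt (m + k\<^sup>2 * (cos t)\<^sup>2)) has_integral
      (- arsinh (k * cos (pi/2) / sqrt m) / k) - (- arsinh (k * cos 0 / sqrt m) / k)) {0..pi/2}"
  proof (rule fundamental_theorem_of_calculus)
    fix t :: real
    have inner: "((\<lambda>t. k * cos t / sqrt m) has_real_derivative k * - sin t / sqrt m) (at t)"
      by (intro DERIV_cdivide DERIV_cmult DERIV_cos)
    have "((\<lambda>t. - arsinh (k * cos t / sqrt m) / k) has_real_derivative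
        - (1 / sqrt ((k * cos t / sqrt m)\<^sup>2 + 1) * (k * - sin t / sqrt m)) / k) (at t within {0..pi/2})"
      by (rule has_field_derivative_at_within, intro DERIV_cdivide DERIV_minus
          DERIV_chain2[OF arsinh_real_has_field_derivative inner])
    moreover have "- (1 / sqrt ((k * cos t / sqrt m)\<^sup>2 + 1) * (k * - sin t / sqrt m)) / k =
        sin t / (sqrt m * sqrt ((k * cos t / sqrt m)\<^sup>2 + 1))"
      using assms by simp
    moreover have "m * ((k * cos t / sqrt m)\<^sup>2 + 1) = m + k\<^sup>2 * (cos t)\<^sup>2"
      using assms by (simp add: power_divide power_mult_distrib field_simps)
    then have "sqrt m * sqrt ((k * cos t / sqrt m)\<^sup>2 + 1) = sqrt (m + k\<^sup>2 * (cos t)\<^sup>2)"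
      by (simp flip: real_sqrt_mult)
    ultimately show "((\<lambda>t. - arsinh (k * cos t / sqrt m) / k) has_vector_derivative
        sin t / sqrt (m + k\<^sup>2 * (cos t)\<^sup>2)) (at t within {0..pi/2})"
      by (simp add: has_real_derivative_iff_has_vector_derivative)
  qed simp
  then show ?thesis by simp
qed

lemma elliptic_K_complement_ge:
  assumes "0 < m" "m < 1"
  shows "elliptic_K (1 - m) \<ge> arsinh (1 / sqrt m)"
proof -
  have "arsinh (1 / sqrt m) / 1 \<le> elliptic_K (1 - m)"
  proof (rule has_integral_le[OF has_integral_sin_over_sqrt elliptic_K_complement_has_integral])
    fix t :: real
    have pos: "0 < m + (1 - m) * (cos t)\<^sup>2"
      using assms by (intro add_pos_nonneg) auto
    have "(1 - m) * (cos t)\<^sup>2 \<le> 1 * (cos t)\<^sup>2"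
      using assms by (intro mult_right_mono) auto
    then have "sqrt (m + (1 - m) * (cos t)\<^sup>2) \<le> sqrt (m + 1\<^sup>2 * (cos t)\<^sup>2)" by simp
    then show "sin t / sqrt (m + 1\<^sup>2 * (cos t)\<^sup>2) \<le> 1 / sqrt (m + (1 - m) * (cos t)\<^sup>2)"
      using pos assms by (intro frac_le) auto
  qed (use assms in auto)
  then show ?thesis by simp
qed

lemma elliptic_K_complement_le:
  assumes "0 < m" "m < 1"
  shows "elliptic_K (1 - m) \<le> (arsinh (sqrt (1 - m) / sqrt m) + pi / 2) / sqrt (1 - m)"
proof -
  define k where "k = sqrt (1 - m)"
  have k: "k > 0" "k\<^sup>2 = 1 - m" using assms by (simp_all add: k_def)
  have int: "((\<lambda>t. sin t / sqrt (m + k\<^sup>2 * (cos t)\<^sup>2) + 1 / k) has_integral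
      arsinh (k / sqrt m) / k + (pi / 2) * (1 / k)) {0..pi/2}"
    using has_integral_const_real[of "1 / k" 0 "pi/2"] k assms
    by (intro has_integral_add has_integral_sin_over_sqrt) auto
  have "elliptic_K (1 - m) \<le> arsinh (k / sqrt m) / k + (pi / 2) * (1 / k)"
  proof (rule has_integral_le[OF elliptic_K_complement_has_integral int])
    fix t :: real assume t: "t \<in> {0..pi/2}"
    have c: "cos t \<ge> 0" and s: "0 \<le> sin t" "sin t \<le> 1"
      using t by (auto intro!: cos_ge_zero sin_ge_zero)
    define D where "D = sqrt (m + k\<^sup>2 * (cos t)\<^sup>2)"
    have D: "D > 0" using assms k by (auto simp: D_def intro!: add_pos_nonneg)
    \<comment> \<open>From 1 - sin t \<le> cos t and k cos t \<le> D, replacing the numerator 1 by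
      sin t changes the integrand by at most 1/k, which is negligible beside the logarithm.\<close>
    have "(1 - sin t)\<^sup>2 \<le> (cos t)\<^sup>2"
      unfolding cos_squared_eq using s mult_left_le[of "sin t" "sin t"]
      by (simp add: power2_eq_square algebra_simps)
    then have "1 - sin t \<le> cos t"
      using c by (rule power2_le_imp_le)
    then have "k * (1 - sin t) \<le> k * cos t"
      using k by simp
    also have "k * cos t = sqrt (k\<^sup>2 * (cos t)\<^sup>2)"
      using k(1) c by (simp add: real_sqrt_mult)
    also have "\<dots> \<le> D" unfolding D_def using assms by simp
    finally have "(1 - sin t) / D \<le> 1 / k"
      using D k(1) by (simp add: field_simps)
    then have "1 / D \<le> sin t / D + 1 / k"
      by (simp add: diff_divide_distrib)
    then show "1 / sqrt (m + (1 - m) * (cos t)\<^sup>2) \<le> sin t / sqrt (m + k\<^sup>2 * (cos t)\<^sup>2) + 1 / k"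
      by (simp add: D_def k(2))
  qed (use assms in auto)
  then show ?thesis by (simp add: k_def add_divide_distrib)
qed

lemma elliptic_K_complement_asymp:
  "((\<lambda>m. elliptic_K (1 - m) / (- ln m)) \<longlongrightarrow> 1/2) (at_right 0)"
proof (rule tendsto_sandwich)
  have ev: "eventually (\<lambda>m::real. 0 < m \<and> m < 1) (at_right 0)"
    unfolding eventually_at_right_field by (rule exI[of _ 1]) auto
  show "eventually (\<lambda>m. arsinh (1 / sqrt m) / (- ln m) \<le> elliptic_K (1 - m) / (- ln m)) (at_right 0)"
    using ev by eventually_elim (rule divide_right_mono[OF elliptic_K_complement_ge], auto)
  show "eventually (\<lambda>m. elliptic_K (1 - m) / (- ln m) \<le>
      (arsinh (sqrt (1 - m) / sqrt m) + pi / 2) / sqrt (1 - m) / (- ln m)) (at_right 0)"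
    using ev by eventually_elim (rule divide_right_mono[OF elliptic_K_complement_le], auto)
  show "((\<lambda>m::real. arsinh (1 / sqrt m) / (- ln m)) \<longlongrightarrow> 1/2) (at_right 0)"
    unfolding arsinh_real_def by real_asymp
  show "((\<lambda>m::real. (arsinh (sqrt (1 - m) / sqrt m) + pi / 2) / sqrt (1 - m) / (- ln m)) \<longlongrightarrow> 1/2) (at_right 0)"
    unfolding arsinh_real_def by real_asymp
qed

section \<open>Inversion of the theta functions\<close>

text \<open>A value at most 0 would be inherited along q^(k^n) and force the limit to be at most
  0.\<close>

lemma pos_of_nonpos_invariant:
  fixes f :: "real \<Rightarrow> real"
  assumes step: "\<And>q. 0 < q \<Longrightarrow> q < 1 \<Longrightarrow> f q \<le> 0 \<Longrightarrow> f (q ^ k) \<le> 0"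
    and q: "0 < q" "q < 1" and k: "1 < k" and lim: "(f \<longlongrightarrow> l) (at_right 0)" "l > 0"
  shows "f q > 0"
proof (rule ccontr)
  assume "\<not> f q > 0"
  have "f (q ^ (k ^ n)) \<le> 0" for n
  proof (induction n)
    case 0
    then show ?case using \<open>\<not> f q > 0\<close> by simp
  next
    case (Suc n)
    have "f ((q ^ (k ^ n)) ^ k) \<le> 0"
      using q k Suc by (intro step) (auto simp: power_less_one_iff)
    then show ?case by (simp add: power_mult[symmetric] mult.commute)
  qed
  moreover have "(\<lambda>n. f (q ^ (k ^ n))) \<longlonglongrightarrow> l"
    by (rule filterlim_compose[OF lim(1) iterated_power_tendsto[OF q k]])
  ultimately have "l \<le> 0"
    by (intro LIMSEQ_le_const2) auto
  with lim(2) show False by simp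
qed

lemma theta2_less_theta3:
  assumes "0 < q" "q < 1"
  shows "theta2 q < theta3 q"
proof -
  have "theta3 q - theta2 q > 0"
  proof (rule pos_of_nonpos_invariant[where f = "\<lambda>q. theta3 q - theta2 q" and k = 2 and l = 1])
    fix q :: real assume q: "0 < q" "q < 1" "theta3 q - theta2 q \<le> 0"
    \<comment> \<open>The left side is a square, hence nonpositive only if it vanishes; the
      difference at q^2 is then 0.\<close>
    have "(theta3 (q\<^sup>2) - theta2 (q\<^sup>2))\<^sup>2 = (theta3 q)\<^sup>2 - (theta2 q)\<^sup>2"
      using q by (simp add: theta3_square theta2_square power2_diff)
    also have "\<dots> \<le> 0"
      using q by (simp add: power_mono theta_nonneg)
    finally show "theta3 (q\<^sup>2) - theta2 (q\<^sup>2) \<le> 0" by simp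
  next
    show "((\<lambda>q. theta3 q - theta2 q) \<longlongrightarrow> 1) (at_right 0)"
      using tendsto_diff[OF theta_tendsto(1,2)] by simp
  qed (use assms in auto)
  then show ?thesis by simp
qed

lemma cubic_theta_c_less_a:
  assumes "0 < q" "q < 1"
  shows "cubic_theta_c q < cubic_theta_a q"
proof -
  have "cubic_theta_a q - cubic_theta_c q > 0"
  proof (rule pos_of_nonpos_invariant[where f = "\<lambda>q. cubic_theta_a q - cubic_theta_c q" and k = 3 and l = 1])
    fix q :: real assume q: "0 < q" "q < 1" "cubic_theta_a q - cubic_theta_c q \<le> 0"
    \<comment> \<open>This is b^3 = a^3 - c^3 with b(q) = a(q^3) - c(q^3); the odd power keeps the
      sign.\<close>
    have "(cubic_theta_a (q ^ 3) - cubic_theta_c (q ^ 3)) ^ 3 = cubic_theta_a q ^ 3 - cubic_theta_c q ^ 3"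
      using q by (simp add: cubic_theta_a_split cubic_theta_c_cube)
        (simp add: algebra_simps power_numeral_reduce)
    also have "\<dots> \<le> 0"
      using q by (simp add: power_mono theta_nonneg)
    finally show "cubic_theta_a (q ^ 3) - cubic_theta_c (q ^ 3) \<le> 0"
      by (simp add: power_le_zero_eq)
  next
    show "((\<lambda>q. cubic_theta_a q - cubic_theta_c q) \<longlongrightarrow> 1) (at_right 0)"
      using tendsto_diff[OF theta_tendsto(3,4)] by simp
  qed (use assms in auto)
  then show ?thesis by simp
qed

lemma cubic_theta_a_eq_hypergeometric:
  assumes "0 < q" "q < 1"
  shows "cubic_theta_a q = ellF (1/3) ((cubic_theta_c q / cubic_theta_a q) ^ 3)"
proof -
  let ?f = "\<lambda>q. cubic_theta_a q / ellF (1/3) ((cubic_theta_c q / cubic_theta_a q) ^ 3)"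
  have "?f q = 1"
  proof (rule invariant_eq_limit[where f = ?f and k = 3])
    fix q :: real assume q: "0 < q" "q < 1"
    define A C where "A = cubic_theta_a (q ^ 3)" and "C = cubic_theta_c (q ^ 3)"
    have q3: "0 < q ^ 3" "q ^ 3 < 1" using q by (auto simp: power_less_one_iff)
    have AC: "0 < C" "C < A"
      using cubic_theta_c_pos[OF q3] cubic_theta_c_less_a[OF q3] by (auto simp: A_def C_def)
    \<comment> \<open>This is b/a at \<open>q\<close>. Hence 1 - x^3 is (c/a)^3 at \<open>q\<close>,
      while the argument on the other side becomes (C/A)^3, the same quotient at q^3.\<close>
    define x where "x = (A - C) / (A + 2 * C)"
    have x: "0 < x" "x \<le> 1" using AC by (auto simp: x_def field_simps)
    have "ellF (1/3) (1 - x ^ 3) = 3 / (1 + 2 * x) * ellF (1/3) (((1 - x) / (1 + 2 * x)) ^ 3)"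
      by (rule ellF_cubic_transformation[OF x])
    also have "3 / (1 + 2 * x) = (A + 2 * C) / A"
      using AC by (simp add: x_def divide_simps) 
    also have "(1 - x) / (1 + 2 * x) = C / A"
      using AC by (simp add: x_def divide_simps) 
    also have "1 - x ^ 3 = (cubic_theta_c q / cubic_theta_a q) ^ 3"
      using AC q
      by (simp add: cubic_theta_a_split power_divide cubic_theta_c_cube x_def A_def[symmetric] C_def[symmetric] divide_simps)
        (simp add: algebra_simps power_numeral_reduce)
    finally show "?f (q ^ 3) = ?f q"
      using AC q by (simp add: cubic_theta_a_split A_def[symmetric] C_def[symmetric])
  next
    have "isCont (ellF (1/3)) 0"
      by (rule ellF_continuous) auto
    moreover have "((\<lambda>q. (cubic_theta_c q / cubic_theta_a q) ^ 3) \<longlongrightarrow> (0 / 1) ^ 3) (at_right 0)"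
      by (intro tendsto_intros theta_tendsto) simp
    ultimately have "((\<lambda>q. ellF (1/3) ((cubic_theta_c q / cubic_theta_a q) ^ 3)) \<longlongrightarrow> ellF (1/3) 0) (at_right 0)"
      by (intro isCont_tendsto_compose[where g = "ellF (1/3)"]) auto
    from tendsto_divide[OF theta_tendsto(3) this] show "(?f \<longlongrightarrow> 1) (at_right 0)"
      by (simp add: ellF_0)
  qed (use assms in auto)
  then show ?thesis
    \<comment> \<open>A zero denominator would make the quotient 0 instead of 1.\<close>
    by (cases "ellF (1/3) ((cubic_theta_c q / cubic_theta_a q) ^ 3) = 0") auto
qed

definition theta_modulus :: "real \<Rightarrow> real" where
  "theta_modulus q = (theta2 q / theta3 q) ^ 4"

lemma theta_modulus_bounds:
  assumes "0 < q" "q < 1"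
  shows "0 < theta_modulus q" "theta_modulus q < 1"
proof -
  have "0 < theta2 q"
    using theta2_ge[OF assms] assms less_le_trans[of 0 "q powr (1/4)"] by simp
  then have "0 < theta2 q / theta3 q" "theta2 q / theta3 q < 1"
    using theta2_less_theta3[OF assms] by auto
  then show "0 < theta_modulus q" "theta_modulus q < 1"
    unfolding theta_modulus_def by (simp_all only: zero_less_power power_less_one_iff) simp
qed

lemma theta_modulus_tendsto: "filterlim theta_modulus (at_right 0) (at_right 0)"
proof -
  have "(theta_modulus \<longlongrightarrow> (0 / 1) ^ 4) (at_right 0)"
    unfolding theta_modulus_def by (intro tendsto_intros theta_tendsto) simp
  moreover have "eventually (\<lambda>q. theta_modulus q > 0) (at_right 0)"
    unfolding eventually_at_right_field using theta_modulus_bounds(1) by (intro exI[of _ 1]) auto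
  ultimately show ?thesis
    by (auto simp: filterlim_at elim: eventually_mono)
qed

text \<open>Here \<open>l\<close> is (theta2/theta3)^2 at q^2, and passing from q to q^2 is the
  Landen step from 4l/(1+l)^2 down to l^2.\<close>

lemma theta_modulus_Landen:
  assumes "0 < q" "q < 1"
  obtains l where "0 < l" "l < 1" "theta_modulus (q\<^sup>2) = l\<^sup>2" "theta_modulus q = 4 * l / (1 + l)\<^sup>2"
    "theta3 q ^ 2 = (1 + l) * theta3 (q\<^sup>2) ^ 2"
proof -
  define X Y where "X = theta3 (q\<^sup>2)" and "Y = theta2 (q\<^sup>2)"
  have q2: "0 < q\<^sup>2" "q\<^sup>2 < 1" using assms by (auto simp: power_less_one_iff)
  have XY: "0 < Y" "Y < X"
    using theta2_less_theta3[OF q2] theta2_ge[OF q2] assms less_le_trans[of 0 "q\<^sup>2 powr (1/4)"]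
    by (auto simp: X_def Y_def)
  let ?l = "(Y / X)\<^sup>2"
  show ?thesis
  proof
    show "0 < ?l" using XY by simp
    have "Y / X < 1" "0 \<le> Y / X" using XY by auto
    then show "?l < 1" by (simp only: power_less_one_iff) simp
    show "theta_modulus (q\<^sup>2) = ?l\<^sup>2"
      by (simp add: theta_modulus_def X_def Y_def power_divide)
    have "theta_modulus q = (theta2 q ^ 2)\<^sup>2 / (theta3 q ^ 2)\<^sup>2"
      by (simp add: theta_modulus_def power_divide)
    also have "\<dots> = (2 * Y * X)\<^sup>2 / (X\<^sup>2 + Y\<^sup>2)\<^sup>2"
      unfolding theta2_square[OF assms] theta3_square[OF assms] X_def Y_def by simp
    also have "\<dots> = 4 * ?l / (1 + ?l)\<^sup>2"
    proof -
      have "1 + ?l = (X\<^sup>2 + Y\<^sup>2) / X\<^sup>2" using XY by (simp add: field_simps)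
      then show ?thesis using XY by (simp add: power_divide power_mult_distrib field_simps power2_eq_square)
    qed
    finally show "theta_modulus q = 4 * ?l / (1 + ?l)\<^sup>2" .
    show "theta3 q ^ 2 = (1 + ?l) * theta3 (q\<^sup>2) ^ 2"
      using XY unfolding theta3_square[OF assms] X_def[symmetric] Y_def[symmetric]
      by (simp add: field_simps)
  qed
qed

lemma theta3_square_eq_elliptic_K:
  assumes "0 < q" "q < 1"
  shows "theta3 q ^ 2 = 2 / pi * elliptic_K (theta_modulus q)"
proof -
  let ?f = "\<lambda>q. theta3 q ^ 2 / ellF (1/2) (theta_modulus q)"
  have "?f q = 1"
  proof (rule invariant_eq_limit[where f = ?f and k = 2])
    fix q :: real assume q: "0 < q" "q < 1"
    from theta_modulus_Landen[OF q] obtain l where l: "0 < l" "l < 1"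
      "theta_modulus (q\<^sup>2) = l\<^sup>2" "theta_modulus q = 4 * l / (1 + l)\<^sup>2"
      "theta3 q ^ 2 = (1 + l) * theta3 (q\<^sup>2) ^ 2" by metis
    then show "?f (q\<^sup>2) = ?f q"
      by (simp add: ellF_Landen)
  next
    have "isCont (ellF (1/2)) 0"
      by (rule ellF_continuous) auto
    moreover have "(theta_modulus \<longlongrightarrow> 0) (at_right 0)"
      using theta_modulus_tendsto by (simp add: filterlim_at)
    ultimately have "((\<lambda>q. ellF (1/2) (theta_modulus q)) \<longlongrightarrow> ellF (1/2) 0) (at_right 0)"
      by (intro isCont_tendsto_compose[where g = "ellF (1/2)"]) auto
    from tendsto_divide[OF tendsto_power[OF theta_tendsto(1), of 2] this]
    show "(?f \<longlongrightarrow> 1) (at_right 0)" by (simp add: ellF_0)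
  qed (use assms in auto)
  moreover have "ellF (1/2) (theta_modulus q) \<ge> 1"
    using theta_modulus_bounds[OF assms] by (intro ellF_ge_1) auto
  ultimately show ?thesis
    using theta_modulus_bounds[OF assms] by (simp add: elliptic_K_eq_ellF)
qed

lemma elliptic_K_ratio_Landen:
  assumes "0 < l" "l < 1"
  shows "elliptic_K (1 - l\<^sup>2) / elliptic_K (l\<^sup>2) =
    2 * (elliptic_K (1 - 4 * l / (1 + l)\<^sup>2) / elliptic_K (4 * l / (1 + l)\<^sup>2))"
proof -
  \<comment> \<open>Since 1 - 4l/(1+l)^2 = x^2 and 1 - l^2 = 4x/(1+x)^2, the complements undergo the
    Landen step in the opposite direction. The factors 1 + l and 1 + x = 2/(1+l) multiply to
    2.\<close>
  define x where "x = (1 - l) / (1 + l)"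
  have x: "0 < x" "x < 1" using assms by (auto simp: x_def)
  have K: "elliptic_K (4 * y / (1 + y)\<^sup>2) = (1 + y) * elliptic_K (y\<^sup>2)" if y: "0 < y" "y < 1" for y
  proof -
    have "(1 + y)\<^sup>2 = 4 * y + (1 - y)\<^sup>2" by (simp add: power2_eq_square algebra_simps)
    moreover have "(1 - y)\<^sup>2 > 0" using y by simp
    ultimately have "4 * y < (1 + y)\<^sup>2" by linarith
    then have "4 * y / (1 + y)\<^sup>2 < 1" using y by simp
    moreover have "y\<^sup>2 < 1" using y by (simp add: power_less_one_iff)
    ultimately show ?thesis using y ellF_Landen[of y] by (simp add: elliptic_K_eq_ellF)
  qed
  have 1: "1 - 4 * l / (1 + l)\<^sup>2 = x\<^sup>2"
    using assms by (simp add: x_def divide_simps) (simp add: algebra_simps power2_eq_square)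
  have x1: "1 + x = 2 / (1 + l)" using assms by (simp add: x_def field_simps)
  have 2: "1 - l\<^sup>2 = 4 * x / (1 + x)\<^sup>2"
    unfolding x1 using assms by (simp add: x_def divide_simps) (simp add: algebra_simps power2_eq_square)
  have 3: "elliptic_K (1 - l\<^sup>2) = 2 / (1 + l) * elliptic_K (x\<^sup>2)"
    using K[OF x, folded 2] by (simp only: x1)
  have "l\<^sup>2 < 1" using assms by (simp add: power_less_one_iff)
  then have "elliptic_K (l\<^sup>2) \<noteq> 0" using elliptic_K_pos[of "l\<^sup>2"] by simp
  then show ?thesis
    unfolding 1 3 K[OF assms] using assms by (simp add: field_simps)
qed

text \<open>theta2^4 lies between q and a multiple of q, theta3^4 between 1 and a constant, so ln m
  - ln q stays bounded while ln q diverges.\<close>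

lemma ln_theta_modulus_asymp: "((\<lambda>q. ln (theta_modulus q) / ln q) \<longlongrightarrow> 1) (at_right 0)"
proof -
  \<comment> \<open>The constants come from \<open>theta2_le\<close> and \<open>theta3_le\<close> at
    q0 = 1/2; the 2 in \<open>B\<close> is 1/q0.\<close>
  define B where "B = 2 * theta2 (1/2) ^ 4"
  define D where "D = (1 + theta3 (1/2)) ^ 4"
  have BD: "B > 0" "D > 0"
  proof -
    have "0 < theta2 (1/2)"
      using theta2_ge[of "1/2"] less_le_trans[of 0 "(1/2) powr (1/4)" "theta2 (1/2)"] by simp
    then show "B > 0" by (simp add: B_def)
    show "D > 0" using theta3_nonneg[of "1/2"] by (simp add: D_def)
  qed
  have bound: "\<bar>ln (theta_modulus q) / ln q - 1\<bar> \<le> (\<bar>ln B\<bar> + \<bar>ln D\<bar>) / \<bar>ln q\<bar>"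
    if q: "0 < q" "q \<le> 1/2" for q
  proof -
    have q1: "q < 1" using q by simp
    have t3: "1 \<le> theta3 q ^ 4" "theta3 q ^ 4 \<le> D"
    proof -
      show "1 \<le> theta3 q ^ 4" using theta3_ge_1[OF q(1) q1] by (rule one_le_power)
      have "theta3 q \<le> 1 + q / (1/2) * theta3 (1/2)" using theta3_le[of q "1/2"] q by simp
      also have "q / (1/2) * theta3 (1/2) \<le> 1 * theta3 (1/2)"
        using q theta3_nonneg by (intro mult_right_mono) auto
      finally show "theta3 q ^ 4 \<le> D" unfolding D_def
        by (intro power_mono) (auto simp: theta3_nonneg)
    qed
    have t2: "q \<le> theta2 q ^ 4" "theta2 q ^ 4 \<le> B * q"
    proof -
      have "q = (q powr (1/4)) ^ 4" using q by (simp add: powr_power)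
      also have "\<dots> \<le> theta2 q ^ 4" using theta2_ge[OF q(1) q1] by (intro power_mono) auto
      finally show "q \<le> theta2 q ^ 4" .
      have "theta2 q ^ 4 \<le> ((q / (1/2)) powr (1/4) * theta2 (1/2)) ^ 4"
        using theta2_le[of q "1/2"] q by (intro power_mono theta2_nonneg) auto
      also have "\<dots> = B * q" using q by (simp add: B_def power_mult_distrib powr_power)
      finally show "theta2 q ^ 4 \<le> B * q" .
    qed
    have m: "theta_modulus q = theta2 q ^ 4 / theta3 q ^ 4"
      by (simp add: theta_modulus_def power_divide)
    have "theta2 q ^ 4 > 0" using t2 q by linarith
    then have "ln (theta_modulus q) = ln (theta2 q ^ 4) - ln (theta3 q ^ 4)"
      unfolding m using theta3_ge_1[OF q(1) q1] by (simp add: ln_div)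
    moreover have "ln q \<le> ln (theta2 q ^ 4)" using t2 q by (subst ln_le_cancel_iff) auto
    moreover have "ln (theta2 q ^ 4) \<le> ln (B * q)"
      using t2 q BD \<open>theta2 q ^ 4 > 0\<close> by (subst ln_le_cancel_iff) auto
    moreover have "ln (B * q) = ln B + ln q" using BD q by (simp add: ln_mult)
    moreover have "0 \<le> ln (theta3 q ^ 4)" using t3 by (intro ln_ge_zero) auto
    moreover have "ln (theta3 q ^ 4) \<le> ln D" using t3 BD by (subst ln_le_cancel_iff) auto
    ultimately have "\<bar>ln (theta_modulus q) - ln q\<bar> \<le> \<bar>ln B\<bar> + \<bar>ln D\<bar>"
      by linarith
    moreover have "ln q < 0" using q by simp
    then have "ln (theta_modulus q) / ln q - 1 = (ln (theta_modulus q) - ln q) / ln q"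
      by (simp add: field_simps)
    ultimately show ?thesis
      by (simp add: divide_right_mono)
  qed
  have "((\<lambda>q. ln (theta_modulus q) / ln q - 1) \<longlongrightarrow> 0) (at_right 0)"
  proof (rule Lim_null_comparison)
    show "eventually (\<lambda>q. norm (ln (theta_modulus q) / ln q - 1) \<le> (\<bar>ln B\<bar> + \<bar>ln D\<bar>) / \<bar>ln q\<bar>) (at_right 0)"
      unfolding eventually_at_right_field using bound by (intro exI[of _ "1/2"]) auto
    show "((\<lambda>q. (\<bar>ln B\<bar> + \<bar>ln D\<bar>) / \<bar>ln q\<bar>) \<longlongrightarrow> 0) (at_right (0::real))"
      by real_asymp
  qed
  then show ?thesis by (simp add: LIM_zero_iff)
qed

lemma elliptic_K_ratio_theta_modulus:
  assumes "0 < q" "q < 1"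
  shows "elliptic_K (1 - theta_modulus q) / elliptic_K (theta_modulus q) = - ln q / pi"
proof -
  let ?R = "\<lambda>m. elliptic_K (1 - m) / elliptic_K m"
  let ?f = "\<lambda>q. ?R (theta_modulus q) / (- ln q)"
  have f: "?f q = 1 / pi"
  proof (rule invariant_eq_limit[where f = ?f and k = 2])
    fix q :: real assume q: "0 < q" "q < 1"
    from theta_modulus_Landen[OF q] obtain l where l: "0 < l" "l < 1"
      "theta_modulus (q\<^sup>2) = l\<^sup>2" "theta_modulus q = 4 * l / (1 + l)\<^sup>2" by metis
    then have "?R (theta_modulus (q\<^sup>2)) = 2 * ?R (theta_modulus q)"
      using elliptic_K_ratio_Landen by simp
    then show "?f (q\<^sup>2) = ?f q"
      using q by (simp add: ln_realpow)
  next
    have "isCont (ellF (1/2)) 0"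
      by (rule ellF_continuous) auto
    then have "((\<lambda>q. pi / 2 * ellF (1/2) (theta_modulus q)) \<longlongrightarrow> pi / 2 * ellF (1/2) 0) (at_right 0)"
      using theta_modulus_tendsto
      by (intro tendsto_mult tendsto_const isCont_tendsto_compose[where g = "ellF (1/2)"])
        (auto simp: filterlim_at)
    then have K: "((\<lambda>q. elliptic_K (theta_modulus q)) \<longlongrightarrow> pi / 2) (at_right 0)"
      unfolding ellF_0 mult_1_right
    proof (rule Lim_transform_eventually)
      show "eventually (\<lambda>q. pi / 2 * ellF (1/2) (theta_modulus q) = elliptic_K (theta_modulus q)) (at_right 0)"
        unfolding eventually_at_right_field using theta_modulus_bounds
        by (intro exI[of _ 1]) (auto simp: elliptic_K_eq_ellF less_imp_le)
    qed
    \<comment> \<open>The limit 1/\<pi> is 1/2, from the growth of K(1-m), times 1, from ln m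
      against ln q, divided by K(0) = \<pi>/2.\<close>
    have "((\<lambda>q. elliptic_K (1 - theta_modulus q) / (- ln (theta_modulus q))) \<longlongrightarrow> 1/2) (at_right 0)"
      by (rule filterlim_compose[OF elliptic_K_complement_asymp theta_modulus_tendsto])
    from tendsto_divide[OF tendsto_mult[OF this ln_theta_modulus_asymp] K]
    have "((\<lambda>q. elliptic_K (1 - theta_modulus q) / (- ln (theta_modulus q)) *
        (ln (theta_modulus q) / ln q) / elliptic_K (theta_modulus q)) \<longlongrightarrow> 1 / pi) (at_right 0)"
      by simp
    then show "(?f \<longlongrightarrow> 1 / pi) (at_right 0)"
    proof (rule Lim_transform_eventually)
      have "elliptic_K (1 - theta_modulus q) / (- ln (theta_modulus q)) *
        (ln (theta_modulus q) / ln q) / elliptic_K (theta_modulus q) = ?f q" if "0 < q" "q < 1" for q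
        using theta_modulus_bounds[OF that] by simp
      then show "eventually (\<lambda>q. elliptic_K (1 - theta_modulus q) / (- ln (theta_modulus q)) *
        (ln (theta_modulus q) / ln q) / elliptic_K (theta_modulus q) = ?f q) (at_right 0)"
        unfolding eventually_at_right_field by (intro exI[of _ 1]) auto
    qed
  qed (use assms in auto)
  have eq: "R = L / pi" if "R / L = 1 / pi" "L \<noteq> 0" for R L :: real
    using that by (simp add: field_simps)
  show ?thesis
    by (rule eq[OF f]) (use assms in simp)
qed

lemma singular_parameter_eq_theta_modulus:
  assumes "s > 0"
  shows "singular_parameter (s\<^sup>2) = theta_modulus (exp (- pi * s))"
  unfolding singular_parameter_def
proof (rule the_equality)
  let ?q = "exp (- pi * s)"
  have q: "0 < ?q" "?q < 1" using assms by auto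
  show *: "0 < theta_modulus ?q \<and> theta_modulus ?q < 1 \<and>
      elliptic_K (1 - theta_modulus ?q) / elliptic_K (theta_modulus ?q) = sqrt (s\<^sup>2)"
    using theta_modulus_bounds[OF q] elliptic_K_ratio_theta_modulus[OF q] assms by simp
  \<comment> \<open>K increases, so the ratio decreases strictly; this is the uniqueness that
    \<open>THE\<close> demands.\<close>
  have less: "elliptic_K (1 - m') / elliptic_K m' < elliptic_K (1 - m) / elliptic_K m"
    if "0 < m" "m < m'" "m' < 1" for m m'
    using that elliptic_K_pos[of m] elliptic_K_less[of m m'] elliptic_K_pos[of "1 - m'"]
      elliptic_K_less[of "1 - m'" "1 - m"]
    by (intro frac_less) auto
  fix m assume "0 < m \<and> m < 1 \<and> elliptic_K (1 - m) / elliptic_K m = sqrt (s\<^sup>2)"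
  with * less[of m "theta_modulus ?q"] less[of "theta_modulus ?q" m]
  show "m = theta_modulus ?q" by (metis less_irrefl linorder_less_linear)
qed

theorem theorem1:
  fixes r :: real
  assumes "r > 0"
  shows "hypergeo_2F1 (1/3) (2/3) 1 (cubic_singular_modulus r) =
    2 / pi
    * root 4 ((1 - singular_modulus (r / 3) ^ 2 + singular_modulus (r / 3) ^ 4)
              / (1 + 8 * cubic_singular_modulus r))
    * elliptic_K (singular_modulus (r / 3) ^ 2)"
proof -
  define s where "s = sqrt (r / 3)"
  define q where "q = exp (- pi * s)"
  have s: "s > 0" "s\<^sup>2 = r / 3" using assms by (simp_all add: s_def)
  have q: "0 < q" "q < 1" using s by (auto simp: q_def)
  have q2: "0 < q\<^sup>2" "q\<^sup>2 < 1" using q by (auto simp: power_less_one_iff)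
  define m where "m = theta_modulus q"
  have m: "0 < m" "m < 1" using theta_modulus_bounds[OF q] by (auto simp: m_def)
  have "singular_parameter (r / 3) = m"
    using singular_parameter_eq_theta_modulus[OF s(1)] by (simp add: s(2) m_def q_def)
  then have sm: "singular_modulus (r / 3) ^ 2 = m" "singular_modulus (r / 3) ^ 4 = m\<^sup>2"
    using m power_add[of "sqrt m" 2 2] by (simp_all add: singular_modulus_def power2_eq_square)
  define a c where "a = cubic_theta_a (q\<^sup>2)" and "c = cubic_theta_c (q\<^sup>2)"
  have a: "a \<ge> 1" and c: "c \<ge> 0"
    using cubic_theta_a_ge_1[OF q2] cubic_theta_c_nonneg by (auto simp: a_def c_def)
  \<comment> \<open>(2 / sqrt 3) sqrt r = 2 sqrt (r/3): this is why \<alpha> at r meets the singular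
    modulus at r/3, with nome q^2 against q.\<close>
  have "exp (- pi * sqrt r) powr (2 / sqrt 3) = q\<^sup>2"
    by (simp add: q_def s_def powr_def real_sqrt_divide flip: exp_of_nat_mult)
  then have csm: "cubic_singular_modulus r = (c / a) ^ 3"
    by (simp add: cubic_singular_modulus_def a_def c_def)
  define \<theta> where "\<theta> = theta3 q"
  have \<theta>: "\<theta> \<ge> 1" using theta3_ge_1[OF q] by (simp add: \<theta>_def)
  \<comment> \<open>The lattice identity uses theta functions at q^2, the parameter m those at q.
    With u = theta3(q)^4 the doubling formulas give u = (X^2+Y^2)^2 and mu = 4X^2Y^2, and then u^2 -
    u(mu) + (mu)^2 = X^8 + 14X^4Y^4 + Y^8.\<close>
  define X Y where "X = theta3 (q\<^sup>2)" and "Y = theta2 (q\<^sup>2)"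
  have "m * \<theta> ^ 4 = (theta2 q ^ 2)\<^sup>2"
    using \<theta> by (simp add: m_def theta_modulus_def \<theta>_def power_divide)
  also have "\<dots> = (2 * Y * X)\<^sup>2"
    by (simp add: theta2_square[OF q] X_def Y_def)
  finally have mt: "m * \<theta> ^ 4 = (2 * Y * X)\<^sup>2" .
  have t: "\<theta> ^ 4 = (X\<^sup>2 + Y\<^sup>2)\<^sup>2"
  proof -
    have "\<theta> ^ 4 = (\<theta>\<^sup>2)\<^sup>2" by simp
    also have "\<theta>\<^sup>2 = X\<^sup>2 + Y\<^sup>2" by (simp add: \<theta>_def X_def Y_def theta3_square[OF q])
    finally show ?thesis .
  qed
  have "a ^ 4 * (1 + 8 * (c / a) ^ 3) = a ^ 4 + 8 * a * c ^ 3"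
    using a by (simp add: power_divide field_simps power_numeral_reduce)
  also have "\<dots> = X ^ 8 + 14 * X ^ 4 * Y ^ 4 + Y ^ 8"
    using cubic_theta_quartic[OF q2] by (simp add: a_def c_def X_def Y_def)
  also have "\<dots> = (\<theta> ^ 4)\<^sup>2 - \<theta> ^ 4 * (m * \<theta> ^ 4) + (m * \<theta> ^ 4)\<^sup>2"
    by (simp only: mt) (simp only: t, simp add: algebra_simps power_numeral_reduce)
  also have "\<dots> = \<theta> ^ 8 * (1 - m + m\<^sup>2)"
    by (simp add: algebra_simps power_numeral_reduce)
  finally have key: "a ^ 4 * (1 + 8 * (c / a) ^ 3) = \<theta> ^ 8 * (1 - m + m\<^sup>2)" .
  have "1 + 8 * (c / a) ^ 3 > 0"
    using a c by (intro add_pos_nonneg) auto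
  then have "(1 - m + m\<^sup>2) / (1 + 8 * (c / a) ^ 3) = (a / \<theta>\<^sup>2) ^ 4"
    using key a \<theta> by (simp add: divide_simps mult.commute flip: power_mult)
  then have "root 4 ((1 - m + m\<^sup>2) / (1 + 8 * (c / a) ^ 3)) = a / \<theta>\<^sup>2"
    using a \<theta> by (simp add: real_root_power_cancel)
  moreover have "2 / pi * elliptic_K m = \<theta>\<^sup>2"
    using theta3_square_eq_elliptic_K[OF q] by (simp add: m_def \<theta>_def)
  moreover have "hypergeo_2F1 (1/3) (2/3) 1 ((c / a) ^ 3) = a"
    using cubic_theta_a_eq_hypergeometric[OF q2] by (simp add: a_def c_def ellF_def)
  moreover have "a = a / \<theta>\<^sup>2 * \<theta>\<^sup>2" using \<theta> by simp
  ultimately show ?thesis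
    unfolding csm sm by (metis mult.assoc mult.commute)
qed

end
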